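(* Let $n,N\ge1$ be integers, let $S_1,\dots,S_N$ be real symmetric $n\times n$ matrices and $R_1,\dots,R_{N-1}\in GL(n,\mathbb{R})$, and let $\mathcal{I}$ be the symmetric block tridiagonal $nN\times nN$ matrix $$\mathcal{I}=\begin{pmatrix}S_1&R_1&0&\dots&0&0\\R_1^t&S_2&R_2&\dots&0&0\\0&R_2^t&S_3&\dots&0&0\\\vdots&\vdots&\vdots&\ddots&\vdots&\vdots\\0&0&0&\dots&S_{N-1}&R_{N-1}\\0&0&0&\dots&R_{N-1}^t&S_N\end{pmatrix}.$$ Let $R_N\in GL(n,\mathbb{R})$ be an arbitrary auxiliary matrix. Then the negative inertia index and the determinant of $\mathcal{I}$ are $$ind^-\mathcal{I}=\sum_{k=1}^N\left(ind^-\mathcal{Q}_k^\perp+\dim\ker\Phi_k^3\right),\qquad \det(\mathcal{I})=(-1)^{nN}\det(\Phi_3)\prod_{k=1}^N\det R_k,$$ where $$\mathcal{Q}_k^\perp=(\Phi_k^3)^t(S_k-I)\Phi_k^3+(\Phi_k^3)^t\Phi_k^1,$$ and the $n\times n$ matrices $\Phi_k^1,\Phi_k^3,\Phi_3$ are built from the $S_k,R_k$ as defined in the context.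
   Context: $I$ is the $n\times n$ identity matrix, ${}^t$ denotes transpose, and the negative inertia index $ind^-$ of a symmetric matrix is its number of negative eigenvalues counted with multiplicity. Define $2n\times2n$ matrices $$M_0=\begin{pmatrix}I&-Q_0\\ I&I-Q_0\end{pmatrix}\quad\text{with } Q_0 \text{ an arbitrary real symmetric } n\times n \text{ matrix (e.g. } Q_0=0),$$ $$M_k=\begin{pmatrix}-R_k^{-1}&R_k^{-1}(I-S_k+R_kR_k^t)\\-R_k^{-1}&R_k^{-1}(I-S_k)\end{pmatrix},\qquad 1\le k\le N,$$ and for $1\le k\le N+1$ the ordered product $$\Phi_k=M_{k-1}M_{k-2}\cdots M_0=\begin{pmatrix}\Phi_k^1&\Phi_k^2\\ \Phi_k^3&\Phi_k^4\end{pmatrix}$$ in $n\times n$ blocks. Finally $\Phi_3:=\Phi_{N+1}^3$. *)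

theory Defs
  imports
    "Jordan_Normal_Form.Char_Poly"
    "Jordan_Normal_Form.Matrix_Kernel"
    "Jordan_Normal_Form.Gauss_Jordan_Elimination"
begin

text \<open>The matrices \<open>S\<^sub>k\<close> and \<open>R\<^sub>k\<close> are given as functions \<open>S R :: nat \<Rightarrow> real mat\<close> whose first
  relevant index is \<open>1\<close>; matrix entries are indexed from \<open>0\<close>, as in the library.\<close>

definition minv :: "real mat \<Rightarrow> real mat" where
  "minv A = the (mat_inverse A)"

lemma minv:
  assumes A: "A \<in> carrier_mat n n" and inv: "invertible_mat A"
  shows "minv A \<in> carrier_mat n n" "A * minv A = 1\<^sub>m n" "minv A * A = 1\<^sub>m n"
proof -
  obtain B where AB: "A * B = 1\<^sub>m n" and BA': "B * A = 1\<^sub>m (dim_row B)"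
    using inv A unfolding invertible_mat_def inverts_mat_def by auto
  have "dim_col B = n"
    using AB by (metis index_mult_mat(3) index_one_mat(3))
  moreover have "dim_row B = n"
    using BA' A by (metis carrier_matD(2) index_mult_mat(3) index_one_mat(3))
  ultimately have B: "B \<in> carrier_mat n n" and BA: "B * A = 1\<^sub>m n"
    using BA' by auto
  have "A \<in> Units (ring_mat TYPE(real) n ())"
    using A B AB BA unfolding Units_def ring_mat_def by auto
  then obtain C where "mat_inverse A = Some C"
    using mat_inverse(1)[OF A, where b = "()"] by (cases "mat_inverse A") auto
  then show "minv A \<in> carrier_mat n n" "A * minv A = 1\<^sub>m n" "minv A * A = 1\<^sub>m n"
    using mat_inverse(2)[OF A] unfolding minv_def by auto
qed

text \<open>Negative eigenvalues are counted with algebraic multiplicity, which for real symmetric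
  matrices agrees with the geometric one.\<close>

definition neg_inertia :: "real mat \<Rightarrow> nat" where
  "neg_inertia A = (\<Sum>x | eigenvalue A x \<and> x < 0. Polynomial.order x (char_poly A))"

text \<open>Entry \<open>(i, j)\<close> lies in the block with (one-based) coordinates
  \<open>(i div n + 1, j div n + 1)\<close>.\<close>

definition block_tridiag :: "nat \<Rightarrow> nat \<Rightarrow> (nat \<Rightarrow> real mat) \<Rightarrow> (nat \<Rightarrow> real mat) \<Rightarrow> real mat" where
  "block_tridiag n N S R = mat (n * N) (n * N) (\<lambda>(i, j).
     let p = i div n + 1; q = j div n + 1; a = i mod n; b = j mod n in
     if p = q then S p $$ (a, b)
     else if q = p + 1 then R p $$ (a, b)
     else if p = q + 1 then (R q)\<^sup>T $$ (a, b)
     else 0)"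

definition M_mat ::
  "nat \<Rightarrow> real mat \<Rightarrow> (nat \<Rightarrow> real mat) \<Rightarrow> (nat \<Rightarrow> real mat) \<Rightarrow> nat \<Rightarrow> real mat" where
  "M_mat n Q0 S R k =
     (if k = 0 then four_block_mat (1\<^sub>m n) (- Q0) (1\<^sub>m n) (1\<^sub>m n - Q0)
      else four_block_mat
        (- minv (R k)) (minv (R k) * (1\<^sub>m n - S k + R k * (R k)\<^sup>T))
        (- minv (R k)) (minv (R k) * (1\<^sub>m n - S k)))"

text \<open>\<open>Phi_mat n Q0 S R k = M\<^sub>k\<^sub>-\<^sub>1 \<cdots> M\<^sub>0\<close>; the value at \<open>0\<close> is the empty product.\<close>

primrec Phi_mat ::
  "nat \<Rightarrow> real mat \<Rightarrow> (nat \<Rightarrow> real mat) \<Rightarrow> (nat \<Rightarrow> real mat) \<Rightarrow> nat \<Rightarrow> real mat" where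
  "Phi_mat n Q0 S R 0 = 1\<^sub>m (2 * n)"
| "Phi_mat n Q0 S R (Suc k) = M_mat n Q0 S R k * Phi_mat n Q0 S R k"

definition Phi1 ::
  "nat \<Rightarrow> real mat \<Rightarrow> (nat \<Rightarrow> real mat) \<Rightarrow> (nat \<Rightarrow> real mat) \<Rightarrow> nat \<Rightarrow> real mat" where
  "Phi1 n Q0 S R k = (case split_block (Phi_mat n Q0 S R k) n n of (A1, A2, A3, A4) \<Rightarrow> A1)"

definition Phi3 ::
  "nat \<Rightarrow> real mat \<Rightarrow> (nat \<Rightarrow> real mat) \<Rightarrow> (nat \<Rightarrow> real mat) \<Rightarrow> nat \<Rightarrow> real mat" where
  "Phi3 n Q0 S R k = (case split_block (Phi_mat n Q0 S R k) n n of (A1, A2, A3, A4) \<Rightarrow> A3)"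

definition Q_perp ::
  "nat \<Rightarrow> real mat \<Rightarrow> (nat \<Rightarrow> real mat) \<Rightarrow> (nat \<Rightarrow> real mat) \<Rightarrow> nat \<Rightarrow> real mat" where
  "Q_perp n Q0 S R k =
     (Phi3 n Q0 S R k)\<^sup>T * (S k - 1\<^sub>m n) * Phi3 n Q0 S R k
     + (Phi3 n Q0 S R k)\<^sup>T * Phi1 n Q0 S R k"

end

theory Submission
  imports Defs "Jordan_Normal_Form.Spectral_Radius" "Jordan_Normal_Form.DL_Rank"
begin

text \<open>
  Write \<open>X\<^sub>k\<close>, \<open>Y\<^sub>k\<close> for the first-column blocks of \<open>\<Phi>\<^sub>k\<close> and \<open>T\<close> for the block tridiagonal matrix.
  The transfer matrices are built so that
  \<open>R\<^sub>k Y\<^sub>k\<^sub>+\<^sub>1 = - (R\<^sub>k\<^sub>-\<^sub>1\<^sup>t Y\<^sub>k\<^sub>-\<^sub>1 + S\<^sub>k Y\<^sub>k)\<close>, that is, \<open>Y\<close> is the matrix solution of the three-term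
  recursion of \<open>T\<close> that starts with \<open>Y\<^sub>0 = 0\<close>, \<open>Y\<^sub>1 = I\<close>, and
  \<open>\<Q>\<^sub>k\<^sup>\<bottom> = - Y\<^sub>k\<^sup>t R\<^sub>k Y\<^sub>k\<^sub>+\<^sub>1\<close> (locale \<open>transfer_matrices\<close>).

  Index formula. Let \<open>F\<^sub>k\<close> be the space of vectors supported on the first \<open>k\<close> blocks and let \<open>W\<^sub>k\<close> send
  \<open>v\<close> to \<open>(Y\<^sub>1 v, \<dots>, Y\<^sub>k v, 0, \<dots>, 0)\<close>. By the recursion \<open>W\<^sub>k v\<close> is \<open>T\<close>-orthogonal to \<open>F\<^sub>k\<^sub>-\<^sub>1\<close>, and the
  quadratic form of \<open>T\<close> pulls back along \<open>W\<^sub>k\<close> to \<open>\<Q>\<^sub>k\<^sup>\<bottom>\<close>. If all \<open>Y\<^sub>k\<close> are invertible, the \<open>W\<^sub>k\<close> together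
  diagonalise \<open>T\<close> into the blocks \<open>\<Q>\<^sub>k\<^sup>\<bottom>\<close> and the formula is Sylvester's law. In general, a vector
  \<open>W\<^sub>k v\<close> with \<open>Y\<^sub>k v = 0\<close> lies in \<open>F\<^sub>k\<^sub>-\<^sub>1\<close> as well as being orthogonal to it, so it is isotropic and
  orthogonal to all the other \<open>W\<^sub>j\<close>. Hence maximal negative subspaces of the \<open>\<Q>\<^sub>k\<^sup>\<bottom>\<close> together with the
  kernels of \<open>Y\<^sub>1, \<dots>, Y\<^sub>N\<^sub>+\<^sub>1\<close> (that of \<open>Y\<^sub>k\<close> embedded by \<open>W\<^sub>k\<^sub>-\<^sub>1\<close>) span a nonpositive subspace for \<open>T\<close>; independence rests on
  \<open>ker Y\<^sub>k \<inter> ker Y\<^sub>k\<^sub>+\<^sub>1 = 0\<close>. With \<open>z\<^sub>k = dim ker Y\<^sub>k\<close> this yields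
  \<open>\<Sum>\<^sub>k (ind\<^sup>- \<Q>\<^sub>k\<^sup>\<bottom> + z\<^sub>k) + z\<^sub>N\<^sub>+\<^sub>1 \<le> ind\<^sup>- T + dim ker T\<close>, and the same inequality holds for \<open>- T\<close> and
  \<open>- \<Q>\<^sub>k\<^sup>\<bottom>\<close>. Since the negative index, the positive index and the nullity of a symmetric matrix add up to its
  size, and since \<open>dim ker T \<le> z\<^sub>N\<^sub>+\<^sub>1\<close> and \<open>dim ker \<Q>\<^sub>k\<^sup>\<bottom> \<le> z\<^sub>k + z\<^sub>k\<^sub>+\<^sub>1\<close>, the sum of the two inequalities
  can only hold with equality; so both are equalities (\<open>orthogonal_flag.neg_inertia_eq\<close>). The
  two-sided count replaces an explicit pairing of the isotropic vectors into hyperbolic planes.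

  The counting needs the eigenvalue definition of the index to agree with dimensions of definite
  subspaces; this comes from orthogonal diagonalisation (\<open>real_symmetric_diagonalization\<close>).

  Determinant formula. Put the \<open>n\<close> rows \<open>(I, 0, \<dots>, 0)\<close> on top of the rows of \<open>T\<close>, extended by \<open>R\<^sub>N\<close> to one
  more block column. The result is block lower triangular with determinant \<open>\<Prod>\<^sub>k det R\<^sub>k\<close>, and it maps
  the column \<open>(Y\<^sub>1, \<dots>, Y\<^sub>N\<^sub>+\<^sub>1)\<close> to \<open>(I, 0, \<dots>, 0)\<close>. Multiplying it by this column followed by the first \<open>nN\<close>
  unit columns leaves \<open>T\<close> as the only nontrivial diagonal block, while the second factor has determinant
  \<open>\<plusminus> det Y\<^sub>N\<^sub>+\<^sub>1\<close>; comparing determinants gives the formula.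
\<close>

section \<open>Independent columns and kernel bases\<close>

text \<open>Subspaces enter only through matrices with independent columns: the number of
  columns is the dimension of the image.\<close>

definition indep_cols :: "'a :: field mat \<Rightarrow> bool" where
  "indep_cols U \<longleftrightarrow>
     (\<forall>v \<in> carrier_vec (dim_col U). U *\<^sub>v v = 0\<^sub>v (dim_row U) \<longrightarrow> v = 0\<^sub>v (dim_col U))"

lemma indep_colsI:
  assumes "U \<in> carrier_mat m d"
    and "\<And>v. v \<in> carrier_vec d \<Longrightarrow> U *\<^sub>v v = 0\<^sub>v m \<Longrightarrow> v = 0\<^sub>v d"
  shows "indep_cols U"
  using assms unfolding indep_cols_def by auto

lemma indep_colsD:
  assumes "indep_cols U" "U \<in> carrier_mat m d" "v \<in> carrier_vec d" "U *\<^sub>v v = 0\<^sub>v m"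
  shows "v = 0\<^sub>v d"
  using assms unfolding indep_cols_def by auto

lemma indep_cols_distinct:
  assumes U: "U \<in> carrier_mat m d" and ind: "indep_cols U"
  shows "distinct (cols U)"
proof (rule ccontr)
  assume "\<not> distinct (cols U)"
  then obtain i j where ij: "i < d" "j < d" "i \<noteq> j" "col U i = col U j"
    using U by (auto simp: distinct_conv_nth)
  have unit: "U *\<^sub>v unit_vec d k = col U k" if "k < d" for k
    using U that by auto
  have "U *\<^sub>v (unit_vec d i - unit_vec d j) = col U i - col U j"
    using mult_minus_distrib_mat_vec[OF U, of "unit_vec d i" "unit_vec d j"] unit ij by simp
  also have "\<dots> = 0\<^sub>v m" using U ij by auto
  finally have "unit_vec d i - unit_vec d j = (0\<^sub>v d :: 'a vec)"
    using indep_colsD[OF ind U] by auto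
  then have "(unit_vec d i - unit_vec d j) $ i = (0\<^sub>v d :: 'a vec) $ i" by simp
  then show False using ij by simp
qed

text \<open>Independent columns form a linearly independent set of vectors in a space of
  dimension \<open>m\<close>. Dimension counts reduce to this bound by concatenating bases of
  subspaces that meet only in \<open>0\<close>.\<close>

lemma indep_cols_le:
  assumes U: "U \<in> carrier_mat m d" and ind: "indep_cols U"
  shows "d \<le> m"
proof -
  interpret vec_space "TYPE('a)" m .
  have dist: "distinct (cols U)" by (rule indep_cols_distinct[OF U ind])
  have "lin_indpt (set (cols U))"
    using lin_depE[OF U _ dist] indep_colsD[OF ind U] by blast
  moreover have "card (set (cols U)) = d"
    using distinct_card[OF dist] U by auto
  ultimately show ?thesis
    using li_le_dim(2)[OF fin_dim, of "set (cols U)"] U cols_dim[of U] dim_is_n by auto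
qed

text \<open>Together with the next lemma this characterises \<open>kernel_dim\<close> as the largest
  number of independent columns annihilated by the matrix, the form in which it enters the
  dimension counts.\<close>

lemma kernel_basis_mat:
  assumes A: "A \<in> carrier_mat r c"
  obtains K where "K \<in> carrier_mat c (kernel_dim A)" "indep_cols K" "A * K = 0\<^sub>m r (kernel_dim A)"
proof -
  interpret kernel r c A by (unfold_locales, rule A)
  obtain B where fin: "finite B" and B: "basis B" using kernel_basis_exists[OF A] by blast
  obtain bs where bs: "set bs = B" "distinct bs" using fin finite_distinct_list by blast
  have Bk: "B \<subseteq> mat_kernel A" using B unfolding Ker.basis_def by auto
  then have Bc: "set bs \<subseteq> carrier_vec c" using bs mat_kernel_carrier[OF A] by auto
  have len: "length bs = kernel_dim A"
    using Ker.dim_basis[OF fin B] distinct_card[OF bs(2)] bs(1) by simp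
  let ?K = "mat_of_cols c bs"
  have K: "?K \<in> carrier_mat c (kernel_dim A)" using len by auto
  have ck: "cols ?K = bs" using Bc by simp
  have nodep: "\<not> NC.lin_dep (set (cols ?K))"
    using B lindep_same[OF Bk] unfolding Ker.basis_def ck bs(1) by auto
  have "indep_cols ?K"
  proof (rule indep_colsI[OF K])
    fix v assume v: "v \<in> carrier_vec (kernel_dim A)" "?K *\<^sub>v v = 0\<^sub>v c"
    show "v = 0\<^sub>v (kernel_dim A)"
      using NC.lin_depI[OF K v(1) _ v(2)] nodep bs ck by auto
  qed
  moreover have "A * ?K = 0\<^sub>m r (kernel_dim A)"
  proof (rule eq_matI)
    fix i j assume ij: "i < dim_row (0\<^sub>m r (kernel_dim A))" "j < dim_col (0\<^sub>m r (kernel_dim A) :: 'a mat)"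
    then have "bs ! j \<in> mat_kernel A" using Bk bs len by auto
    then have z: "A *\<^sub>v (bs ! j) = 0\<^sub>v r" using mat_kernelD[OF A] by auto
    have "col ?K j = bs ! j" using ij len cols_nth[of j ?K] by (simp add: ck)
    then have "(A * ?K) $$ (i,j) = (A *\<^sub>v (bs ! j)) $ i" using A K ij by auto
    then show "(A * ?K) $$ (i,j) = 0\<^sub>m r (kernel_dim A) $$ (i,j)" using z ij by simp
  qed (use A K in auto)
  ultimately show ?thesis using that K by blast
qed

lemma indep_cols_le_kernel_dim:
  assumes A: "A \<in> carrier_mat r c" and K: "K \<in> carrier_mat c d" and ind: "indep_cols K"
    and AK: "\<And>v. v \<in> carrier_vec d \<Longrightarrow> A *\<^sub>v (K *\<^sub>v v) = 0\<^sub>v r"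
  shows "d \<le> kernel_dim A"
proof -
  interpret kernel r c A by (unfold_locales, rule A)
  have dist: "distinct (cols K)" by (rule indep_cols_distinct[OF K ind])
  have ker: "set (cols K) \<subseteq> mat_kernel A"
  proof
    fix x assume "x \<in> set (cols K)"
    then obtain j where j: "j < d" "x = col K j" using K by (auto simp: cols_def)
    then have "x = K *\<^sub>v unit_vec d j" using K by auto
    then have "A *\<^sub>v x = 0\<^sub>v r" using AK j by auto
    then show "x \<in> mat_kernel A" using j K by (intro mat_kernelI[OF A]) auto
  qed
  have "\<not> NC.lin_dep (set (cols K))"
    using NC.lin_depE[OF K _ dist] indep_colsD[OF ind K] by blast
  then have "\<not> Ker.lin_dep (set (cols K))" using lindep_same[OF ker] by simp
  moreover have "Ker.fin_dim"
    using kernel_basis_exists[OF A] ker unfolding Ker.basis_def Ker.fin_dim_def by auto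
  ultimately have "card (set (cols K)) \<le> dim"
    using Ker.li_le_dim(2)[of "set (cols K)"] ker by auto
  then show ?thesis using distinct_card[OF dist] K by simp
qed

text \<open>Blocks of height zero turn \<open>four_block_mat\<close> into horizontal concatenation.\<close>

definition hcat :: "'a :: zero mat \<Rightarrow> 'a mat \<Rightarrow> 'a mat" where
  "hcat U V = four_block_mat U V (0\<^sub>m 0 (dim_col U)) (0\<^sub>m 0 (dim_col V))"

lemma hcat_carrier:
  assumes "U \<in> carrier_mat m a" "V \<in> carrier_mat m b"
  shows "hcat U V \<in> carrier_mat m (a + b)"
  using assms unfolding hcat_def by auto

lemma hcat_mult_vec:
  fixes U V :: "'a :: comm_ring_1 mat"
  assumes U: "U \<in> carrier_mat m a" and V: "V \<in> carrier_mat m b"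
    and u: "u \<in> carrier_vec a" and v: "v \<in> carrier_vec b"
  shows "hcat U V *\<^sub>v (u @\<^sub>v v) = U *\<^sub>v u + V *\<^sub>v v"
proof -
  have "hcat U V *\<^sub>v (u @\<^sub>v v)
      = (U *\<^sub>v u + V *\<^sub>v v) @\<^sub>v (0\<^sub>m 0 a *\<^sub>v u + 0\<^sub>m 0 b *\<^sub>v v)"
    unfolding hcat_def using four_block_mat_mult_vec[OF U V _ _ u v, of "0\<^sub>m 0 a" 0 "0\<^sub>m 0 b"] U V by simp
  also have "\<dots> = U *\<^sub>v u + V *\<^sub>v v" using U V u v by (intro eq_vecI) auto
  finally show ?thesis .
qed

lemma split_vec:
  assumes "w \<in> carrier_vec (a + b)"
  obtains u v where "u \<in> carrier_vec a" "v \<in> carrier_vec b" "w = u @\<^sub>v v"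
  using that[of "vec_first w a" "vec_last w b"] vec_first_last_append[OF assms] by auto

lemma indep_cols_hcat:
  fixes U V :: "'a :: field mat"
  assumes U: "U \<in> carrier_mat m a" and V: "V \<in> carrier_mat m b"
    and "\<And>u v. u \<in> carrier_vec a \<Longrightarrow> v \<in> carrier_vec b \<Longrightarrow> U *\<^sub>v u + V *\<^sub>v v = 0\<^sub>v m
           \<Longrightarrow> u = 0\<^sub>v a \<and> v = 0\<^sub>v b"
  shows "indep_cols (hcat U V)"
proof (rule indep_colsI[OF hcat_carrier[OF U V]])
  fix w assume w: "w \<in> carrier_vec (a + b)" and 0: "hcat U V *\<^sub>v w = 0\<^sub>v m"
  obtain u v where uv: "u \<in> carrier_vec a" "v \<in> carrier_vec b" "w = u @\<^sub>v v"
    using split_vec[OF w] .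
  with 0 hcat_mult_vec[OF U V uv(1,2)] assms(3)[OF uv(1,2)] have "u = 0\<^sub>v a" "v = 0\<^sub>v b" by auto
  then show "w = 0\<^sub>v (a + b)" using uv by auto
qed

section \<open>Diagonalising real symmetric matrices\<close>

lemma inner_self_pos:
  fixes v :: "real vec"
  assumes "v \<in> carrier_vec m" "v \<noteq> 0\<^sub>v m"
  shows "v \<bullet> v > 0"
proof -
  obtain i where i: "i < m" "v $ i \<noteq> 0" using assms by (metis carrier_vecD eq_vecI index_zero_vec)
  have "v \<bullet> v = (\<Sum>j<m. (v $ j)\<^sup>2)"
    using assms(1) by (auto simp: scalar_prod_def power2_eq_square lessThan_atLeast0)
  also have "\<dots> > 0" by (rule sum_pos2[of _ i]) (use i in auto)
  finally show ?thesis .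
qed

lemma inner_mult_mat_vec:
  fixes A :: "'a :: comm_ring_1 mat"
  assumes "A \<in> carrier_mat r c" "u \<in> carrier_vec c" "v \<in> carrier_vec r"
  shows "(A *\<^sub>v u) \<bullet> v = u \<bullet> (A\<^sup>T *\<^sub>v v)"
proof -
  have "(A *\<^sub>v u) \<bullet> v = v \<bullet> (A *\<^sub>v u)" by (rule comm_scalar_prod) (use assms in auto)
  also have "\<dots> = (A\<^sup>T *\<^sub>v v) \<bullet> u" using transpose_vec_mult_scalar[OF assms] by simp
  also have "\<dots> = u \<bullet> (A\<^sup>T *\<^sub>v v)" by (rule comm_scalar_prod) (use assms in auto)
  finally show ?thesis .
qed

text \<open>Over the complex numbers an eigenvalue \<open>z\<close> exists. For its eigenvector \<open>w\<close> the number
  \<open>w\<^sup>* A w = z (w\<^sup>* w)\<close> equals its own conjugate because \<open>A\<close> is real symmetric, so \<open>z\<close> is real, a root of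
  the real characteristic polynomial, and hence has a real eigenvector.\<close>

lemma real_symmetric_eigenvector:
  fixes A :: "real mat"
  assumes A: "A \<in> carrier_mat m m" and sym: "A\<^sup>T = A" and m: "m > 0"
  obtains e v where "v \<in> carrier_vec m" "v \<bullet> v = 1" "A *\<^sub>v v = e \<cdot>\<^sub>v v"
proof -
  let ?C = "map_mat complex_of_real A"
  have C: "?C \<in> carrier_mat m m" using A by auto
  obtain z where z: "eigenvalue ?C z"
    using spectrum_non_empty[OF C m] unfolding spectrum_def by auto
  then obtain w where w: "w \<in> carrier_vec m" "w \<noteq> 0\<^sub>v m" "?C *\<^sub>v w = z \<cdot>\<^sub>v w"
    unfolding eigenvalue_def eigenvector_def using A by auto
  have symij: "A $$ (i,j) = A $$ (j,i)" if "i < m" "j < m" for i j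
    using arg_cong[OF sym, of "\<lambda>M. M $$ (i,j)"] A that by simp
  \<comment> \<open>\<open>?H\<close> is \<open>w\<^sup>* A w\<close> and \<open>?n\<close> is \<open>w\<^sup>* w\<close>.\<close>
  let ?H = "\<Sum>i<m. \<Sum>j<m. cnj (w $ i) * complex_of_real (A $$ (i,j)) * w $ j"
  let ?n = "\<Sum>i<m. cnj (w $ i) * w $ i"
  have row: "(\<Sum>j<m. complex_of_real (A $$ (i,j)) * w $ j) = z * w $ i" if i: "i < m" for i
  proof -
    have "(?C *\<^sub>v w) $ i = (\<Sum>j<m. complex_of_real (A $$ (i,j)) * w $ j)"
      using i A w(1) by (auto simp: scalar_prod_def lessThan_atLeast0 intro!: sum.cong)
    then show ?thesis using w i by simp
  qed
  have H: "?H = z * ?n"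
  proof -
    have "?H = (\<Sum>i<m. cnj (w $ i) * (\<Sum>j<m. complex_of_real (A $$ (i,j)) * w $ j))"
      by (simp add: sum_distrib_left mult.assoc)
    also have "\<dots> = (\<Sum>i<m. cnj (w $ i) * (z * w $ i))" using row by auto
    finally show ?thesis by (simp add: sum_distrib_left mult.left_commute)
  qed
  have "cnj ?H = (\<Sum>i<m. \<Sum>j<m. w $ i * complex_of_real (A $$ (i,j)) * cnj (w $ j))" by simp
  also have "\<dots> = (\<Sum>j<m. \<Sum>i<m. w $ i * complex_of_real (A $$ (i,j)) * cnj (w $ j))"
    by (rule sum.swap)
  also have "\<dots> = ?H" by (intro sum.cong refl) (auto simp: symij)
  finally have H_real: "cnj ?H = ?H" .
  have n: "?n = complex_of_real (\<Sum>i<m. (cmod (w $ i))\<^sup>2)"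
    by (simp only: of_real_sum complex_norm_square mult.commute[of "cnj _"])
  obtain i where "i < m" "w $ i \<noteq> 0" using w by (metis carrier_vecD eq_vecI index_zero_vec)
  then have "(\<Sum>i<m. (cmod (w $ i))\<^sup>2) > 0" by (intro sum_pos2[of _ i]) auto
  then have n0: "?n \<noteq> 0" "cnj ?n = ?n" unfolding n by (auto simp del: of_real_sum)
  have "cnj z * cnj ?n = z * ?n" using H_real unfolding H complex_cnj_mult .
  then have "cnj z = z" using n0 by simp
  then obtain e where e: "z = complex_of_real e" by (metis Reals_cases Reals_cnj_iff)
  have "poly (char_poly ?C) z = 0" using z eigenvalue_root_char_poly[OF C] by simp
  then have "poly (char_poly A) e = 0"
    unfolding e of_real_hom.char_poly_hom[OF A] by simp
  then have "eigenvalue A e" using eigenvalue_root_char_poly[OF A] by simp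
  then obtain u where u: "u \<in> carrier_vec m" "u \<noteq> 0\<^sub>v m" "A *\<^sub>v u = e \<cdot>\<^sub>v u"
    unfolding eigenvalue_def eigenvector_def using A by auto
  \<comment> \<open>Normalise the eigenvector.\<close>
  have pos: "u \<bullet> u > 0" by (rule inner_self_pos[OF u(1,2)])
  let ?c = "1 / sqrt (u \<bullet> u)"
  have "(?c \<cdot>\<^sub>v u) \<bullet> (?c \<cdot>\<^sub>v u) = ?c * ?c * (u \<bullet> u)" using u by simp
  also have "\<dots> = 1" using pos by (simp add: field_simps)
  finally have "(?c \<cdot>\<^sub>v u) \<bullet> (?c \<cdot>\<^sub>v u) = 1" .
  moreover have "A *\<^sub>v (?c \<cdot>\<^sub>v u) = e \<cdot>\<^sub>v (?c \<cdot>\<^sub>v u)"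
    using u A by (simp add: mult_mat_vec smult_smult_assoc mult.commute)
  ultimately show ?thesis using that[of "?c \<cdot>\<^sub>v u" e] u by auto
qed

text \<open>The Householder reflection in the hyperplane orthogonal to \<open>v - e\<^sub>0\<close> exchanges \<open>e\<^sub>0\<close>
  and the unit vector \<open>v\<close>. Being symmetric and an involution, it completes \<open>v\<close> to an orthonormal basis
  without Gram--Schmidt.\<close>

lemma orthogonal_reflection_to:
  fixes v :: "real vec"
  assumes v: "v \<in> carrier_vec m" and norm: "v \<bullet> v = 1" and m: "m > 0"
  obtains P where "P \<in> carrier_mat m m" "P\<^sup>T = P" "P * P = 1\<^sub>m m" "P *\<^sub>v unit_vec m 0 = v"
proof (cases "v = unit_vec m 0")
  case True
  then show ?thesis using that[of "1\<^sub>m m"] by auto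
next
  case False
  define w where "w = v - unit_vec m 0"
  have w: "w \<in> carrier_vec m" using v unfolding w_def by auto
  have wi: "w $ i = v $ i - (if i = 0 then 1 else 0)" if "i < m" for i
    using that v m unfolding w_def by (auto simp: unit_vec_def)
  have "w \<noteq> 0\<^sub>v m"
  proof
    assume w0: "w = 0\<^sub>v m"
    have "v $ i = unit_vec m 0 $ i" if "i < m" for i
      using arg_cong[OF w0, of "\<lambda>x. x $ i"] wi[OF that] that m by (auto simp: unit_vec_def)
    then have "v = unit_vec m 0" using v by (intro eq_vecI) auto
    with False show False ..
  qed
  then have wpos: "w \<bullet> w > 0" by (rule inner_self_pos[OF w])
  have sp: "x \<bullet> y = (\<Sum>j<m. x $ j * y $ j)" if "y \<in> carrier_vec m" for x y :: "real vec"
    using that by (auto simp: scalar_prod_def lessThan_atLeast0)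
  have "(\<Sum>j<m. w $ j * w $ j)
      = (\<Sum>j<m. v $ j * v $ j + (if j = 0 then 1 - 2 * v $ j else 0))"
    by (intro sum.cong refl) (auto simp: wi algebra_simps)
  also have "\<dots> = 2 - 2 * v $ 0"
    using norm m by (simp add: sum.distrib sp[OF v])
  finally have ww: "w \<bullet> w = 2 - 2 * v $ 0" by (simp add: sp[OF w])
  \<comment> \<open>\<open>P\<close> below is \<open>I - c w w\<^sup>t\<close>; this \<open>c\<close> makes it an involution.\<close>
  define c where "c = 2 / (w \<bullet> w)"
  have c: "c * (w \<bullet> w) = 2" using wpos unfolding c_def by simp
  define P where "P = mat m m (\<lambda>(i,j). (if i = j then 1 else 0) - c * w $ i * w $ j)"
  have P: "P \<in> carrier_mat m m" unfolding P_def by auto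
  have "P * P = 1\<^sub>m m"
  proof (rule eq_matI)
    fix i j assume ij: "i < dim_row (1\<^sub>m m :: real mat)" "j < dim_col (1\<^sub>m m :: real mat)"
    then have "(P * P) $$ (i,j) = (\<Sum>k<m. ((if i = k then 1 else 0) - c * w $ i * w $ k)
        * ((if k = j then 1 else 0) - c * w $ k * w $ j))"
      by (auto simp: P_def scalar_prod_def lessThan_atLeast0)
    also have "\<dots> = (\<Sum>k<m. (if k = i then (if i = j then 1 else 0) - c * w $ i * w $ j else 0)
        + (if k = j then - c * w $ i * w $ j else 0) + c * c * w $ i * w $ j * (w $ k * w $ k))"
      by (intro sum.cong refl) (auto simp: algebra_simps)
    also have "\<dots> = (if i = j then 1 else 0) - 2 * c * w $ i * w $ j
        + c * w $ i * w $ j * (c * (w \<bullet> w))"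
      using ij by (simp add: sum.distrib sum_distrib_left[symmetric] sp[OF w])
    finally show "(P * P) $$ (i,j) = 1\<^sub>m m $$ (i,j)" using ij by (simp add: c)
  qed (auto simp: P_def)
  moreover have "P\<^sup>T = P" by (intro eq_matI) (auto simp: P_def)
  moreover have "P *\<^sub>v unit_vec m 0 = v"
  proof (rule eq_vecI)
    fix i assume i: "i < dim_vec v"
    have "(P *\<^sub>v unit_vec m 0) $ i = P $$ (i,0)" using P i v m by auto
    also have "\<dots> = (if i = 0 then 1 else 0) - (c * w $ 0) * w $ i"
      using i v m by (auto simp: P_def)
    also have "c * w $ 0 = - (c * (w \<bullet> w)) / 2"
    proof -
      have "v $ 0 = 1 + w $ 0" using wi[OF m] by simp
      then show ?thesis unfolding ww by (simp add: algebra_simps)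
    qed
    also have "\<dots> = - 1" by (simp add: c)
    finally show "(P *\<^sub>v unit_vec m 0) $ i = v $ i" using i v wi[of i] by auto
  qed (use P v in auto)
  ultimately show ?thesis using that P by blast
qed

lemma mat_diag_mult_vec:
  fixes e :: "nat \<Rightarrow> 'a :: comm_ring_1"
  assumes "v \<in> carrier_vec k"
  shows "mat_diag k e *\<^sub>v v = vec k (\<lambda>c. e c * v $ c)"
proof (rule eq_vecI)
  fix i assume i: "i < dim_vec (vec k (\<lambda>c. e c * v $ c))"
  have "(mat_diag k e *\<^sub>v v) $ i = (\<Sum>c<k. (if i = c then e c else 0) * v $ c)"
    using i assms by (auto simp: mat_diag_def scalar_prod_def lessThan_atLeast0 intro!: sum.cong)
  also have "\<dots> = (\<Sum>c<k. if c = i then e i * v $ i else 0)" by (intro sum.cong) auto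
  finally show "(mat_diag k e *\<^sub>v v) $ i = vec k (\<lambda>c. e c * v $ c) $ i" using i by simp
qed (auto simp: mat_diag_def)

lemma mult_mat_vec_zero:
  fixes A B :: "'a :: comm_ring_1 mat"
  assumes "A \<in> carrier_mat r c" "B \<in> carrier_mat c k" "A * B = 0\<^sub>m r k" "v \<in> carrier_vec k"
  shows "A *\<^sub>v (B *\<^sub>v v) = 0\<^sub>v r"
proof -
  have "A *\<^sub>v (B *\<^sub>v v) = 0\<^sub>m r k *\<^sub>v v"
    using assoc_mult_mat_vec[OF assms(1,2,4)] assms(3) by simp
  also have "\<dots> = 0\<^sub>v r" using assms(4) by (intro eq_vecI) (auto simp: scalar_prod_def)
  finally show ?thesis .
qed

lemma mult_mat_zero_vec:
  fixes A :: "'a :: comm_ring_1 mat"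
  assumes "A \<in> carrier_mat r c"
  shows "A *\<^sub>v 0\<^sub>v c = 0\<^sub>v r"
  using assms by (intro eq_vecI) auto

lemma mat_diag_Suc:
  "mat_diag (1 + m) d
    = four_block_mat (mat 1 1 (\<lambda>_. d 0)) (0\<^sub>m 1 m) (0\<^sub>m m 1) (mat_diag m (\<lambda>j. d (Suc j)))"
  by (rule eq_matI) (auto simp: mat_diag_def)

text \<open>Induction on the size. Conjugating by a reflection that moves an eigenvector to \<open>e\<^sub>0\<close>
  makes the first column, and by symmetry the first row, a multiple of \<open>e\<^sub>0\<close>; what remains is a
  smaller symmetric block.\<close>

theorem real_symmetric_diagonalization:
  fixes A :: "real mat"
  assumes "A \<in> carrier_mat m m" "A\<^sup>T = A"
  shows "\<exists>P d. P \<in> carrier_mat m m \<and> P\<^sup>T * P = 1\<^sub>m m \<and> A * P = P * mat_diag m d"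
  using assms
proof (induction m arbitrary: A)
  case 0
  then show ?case by (intro exI[of _ "1\<^sub>m 0"] exI[of _ "\<lambda>_. 0"]) (auto intro!: eq_matI simp: mat_diag_def)
next
  case (Suc m)
  then have A: "A \<in> carrier_mat (1 + m) (1 + m)" and sym: "A\<^sup>T = A" by auto
  obtain e v where v: "v \<in> carrier_vec (1 + m)" "v \<bullet> v = 1" and ev: "A *\<^sub>v v = e \<cdot>\<^sub>v v"
    using real_symmetric_eigenvector[OF A sym] by (metis zero_less_Suc plus_1_eq_Suc)
  obtain H where H: "H \<in> carrier_mat (1 + m) (1 + m)" "H\<^sup>T = H" "H * H = 1\<^sub>m (1 + m)"
      and Hv: "H *\<^sub>v unit_vec (1 + m) 0 = v"
    using orthogonal_reflection_to[OF v] by auto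
  have HA: "H * A \<in> carrier_mat (1 + m) (1 + m)" and AH: "A * H \<in> carrier_mat (1 + m) (1 + m)"
    using H A by auto
  define B where "B = H * A * H"
  have B: "B \<in> carrier_mat (1 + m) (1 + m)" using H A unfolding B_def by auto
  have "B\<^sup>T = H\<^sup>T * (H * A)\<^sup>T" unfolding B_def using transpose_mult[OF HA H(1)] .
  also have "(H * A)\<^sup>T = A\<^sup>T * H\<^sup>T" using transpose_mult[OF H(1) A] .
  finally have Bsym: "B\<^sup>T = B"
    unfolding H(2) sym B_def using assoc_mult_mat[OF H(1) A H(1)] by simp
  have "H *\<^sub>v v = (H * H) *\<^sub>v unit_vec (1 + m) 0"
    using assoc_mult_mat_vec[OF H(1) H(1), of "unit_vec (1 + m) 0"] Hv by simp
  then have Hv': "H *\<^sub>v v = unit_vec (1 + m) 0" unfolding H(3) by simp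
  have "B *\<^sub>v unit_vec (1 + m) 0 = H *\<^sub>v (A *\<^sub>v (H *\<^sub>v unit_vec (1 + m) 0))"
    unfolding B_def using assoc_mult_mat_vec[OF HA H(1)] assoc_mult_mat_vec[OF H(1) A] H by simp
  also have "\<dots> = e \<cdot>\<^sub>v unit_vec (1 + m) 0"
    unfolding Hv ev using mult_mat_vec[OF H(1) v(1)] Hv' by simp
  finally have Be: "B *\<^sub>v unit_vec (1 + m) 0 = e \<cdot>\<^sub>v unit_vec (1 + m) 0" .
  have Bi0: "B $$ (i,0) = (if i = 0 then e else 0)" if "i < 1 + m" for i
  proof -
    have "B $$ (i,0) = (B *\<^sub>v unit_vec (1 + m) 0) $ i" using B that by auto
    then show ?thesis unfolding Be using that by (simp add: unit_vec_def)
  qed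
  have B0i: "B $$ (0,i) = (if i = 0 then e else 0)" if "i < 1 + m" for i
    using arg_cong[OF Bsym, of "\<lambda>M. M $$ (0,i)"] Bi0[OF that] B that by simp
  define C where "C = mat m m (\<lambda>(i,j). B $$ (Suc i, Suc j))"
  have C: "C \<in> carrier_mat m m" unfolding C_def by auto
  have "C $$ (j,i) = C $$ (i,j)" if "i < m" "j < m" for i j
    using arg_cong[OF Bsym, of "\<lambda>M. M $$ (Suc i, Suc j)"] B that by (simp add: C_def)
  then have "C\<^sup>T = C" using C by (intro eq_matI) auto
  then obtain P d where P: "P \<in> carrier_mat m m" "P\<^sup>T * P = 1\<^sub>m m" "C * P = P * mat_diag m d"
    using Suc.IH[OF C] by blast
  define P2 where "P2 = four_block_mat (1\<^sub>m 1) (0\<^sub>m 1 m) (0\<^sub>m m 1) P"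
  define E where "E = mat 1 1 (\<lambda>_. e)"
  have E: "E \<in> carrier_mat 1 1" unfolding E_def by simp
  define d2 where "d2 = case_nat e d"
  have P2: "P2 \<in> carrier_mat (1 + m) (1 + m)"
    unfolding P2_def using P(1) by (intro four_block_carrier_mat) auto
  have D2: "mat_diag (1 + m) d2
      = four_block_mat (E) (0\<^sub>m 1 m) (0\<^sub>m m 1) (mat_diag m d)"
    unfolding mat_diag_Suc d2_def E_def by simp
  have B4: "B = four_block_mat (E) (0\<^sub>m 1 m) (0\<^sub>m m 1) C"
    by (rule eq_matI) (use B Bi0 B0i in \<open>auto simp: C_def E_def\<close>)
  have orth2: "P2\<^sup>T * P2 = 1\<^sub>m (1 + m)"
  proof -
    have PT: "P2\<^sup>T = four_block_mat (1\<^sub>m 1) (0\<^sub>m 1 m) (0\<^sub>m m 1) P\<^sup>T"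
      unfolding P2_def using P(1) by (subst transpose_four_block_mat) auto
    have "P2\<^sup>T * P2 = four_block_mat (1\<^sub>m 1) (0\<^sub>m 1 m) (0\<^sub>m m 1) (1\<^sub>m m)"
      unfolding PT unfolding P2_def using P by (subst mult_four_block_mat[of _ 1 1 _ m _ m _ _ 1 _ m]) auto
    then show ?thesis by (auto intro!: eq_matI)
  qed
  have BP2: "B * P2 = P2 * mat_diag (1 + m) d2"
  proof -
    have "B * P2 = four_block_mat (E) (0\<^sub>m 1 m) (0\<^sub>m m 1) (C * P)"
      unfolding B4 P2_def using P(1) C E
      by (subst mult_four_block_mat[of _ 1 1 _ m _ m _ _ 1 _ m]) (auto simp del: One_nat_def)
    moreover have "P2 * mat_diag (1 + m) d2
        = four_block_mat (E) (0\<^sub>m 1 m) (0\<^sub>m m 1) (P * mat_diag m d)"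
      unfolding D2 P2_def
      using P(1) E mat_diag_dim[of m d] left_mult_zero_mat[OF mat_diag_dim[of m d], of 1]
      by (subst mult_four_block_mat[of _ 1 1 _ m _ m _ _ 1 _ m]) (auto simp del: One_nat_def)
    ultimately show ?thesis using P(3) by simp
  qed
  have HP: "H * P2 \<in> carrier_mat (1 + m) (1 + m)" using H P2 by auto
  have "(H * P2)\<^sup>T * (H * P2) = (P2\<^sup>T * H) * (H * P2)"
    using transpose_mult[OF H(1) P2] H(2) by simp
  also have "\<dots> = P2\<^sup>T * (H * (H * P2))"
    by (rule assoc_mult_mat) (use P2 H in auto)
  also have "H * (H * P2) = P2"
    using assoc_mult_mat[OF H(1) H(1) P2] H(3) P2 by simp
  finally have 1: "(H * P2)\<^sup>T * (H * P2) = 1\<^sub>m (1 + m)" using orth2 by simp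
  have HB: "H * B = A * H"
  proof -
    have "H * B = H * (H * (A * H))" unfolding B_def using assoc_mult_mat[OF H(1) A H(1)] by simp
    also have "\<dots> = (H * H) * (A * H)" using assoc_mult_mat[OF H(1) H(1) AH] by simp
    finally show ?thesis unfolding H(3) left_mult_one_mat[OF AH] .
  qed
  have "A * (H * P2) = (A * H) * P2" using assoc_mult_mat[OF A H(1) P2] by simp
  also have "\<dots> = H * (B * P2)" unfolding HB[symmetric] using assoc_mult_mat[OF H(1) B P2] by simp
  also have "\<dots> = (H * P2) * mat_diag (1 + m) d2"
    unfolding BP2 using assoc_mult_mat[OF H(1) P2 mat_diag_dim] by simp
  finally have 2: "A * (H * P2) = (H * P2) * mat_diag (1 + m) d2" .
  show ?case using HP 1 2 by auto
qed

text \<open>Similarity to a diagonal matrix splits the characteristic polynomial into linear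
  factors, and the order of a root counts how often it occurs on the diagonal.\<close>

lemma neg_inertia_diagonalized:
  assumes A: "A \<in> carrier_mat m m" and P: "P \<in> carrier_mat m m" "P\<^sup>T * P = 1\<^sub>m m"
    and AP: "A * P = P * mat_diag m d"
  shows "neg_inertia A = card {j. j < m \<and> d j < 0}"
proof -
  have PP: "P * P\<^sup>T = 1\<^sub>m m" using mat_mult_left_right_inverse[OF _ P(1) P(2)] P(1) by auto
  have "A = A * (P * P\<^sup>T)" using A PP by simp
  also have "\<dots> = (P * mat_diag m d) * P\<^sup>T"
    using assoc_mult_mat[OF A P(1), of "P\<^sup>T" m] P(1) AP by simp
  finally have "similar_mat A (mat_diag m d)"
    unfolding similar_mat_def similar_mat_wit_def using A P PP
    by (intro exI[of _ P] exI[of _ "P\<^sup>T"]) (auto simp: Let_def)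
  then have "char_poly A = char_poly (mat_diag m d)" by (rule char_poly_similar)
  also have "\<dots> = (\<Prod>a \<leftarrow> diag_mat (mat_diag m d). [:- a, 1:])"
    by (rule char_poly_upper_triangular[of _ m]) (auto simp: mat_diag_def)
  also have "diag_mat (mat_diag m d) = map d [0..<m]"
    by (auto simp: diag_mat_def mat_diag_def)
  finally have cp: "char_poly A = (\<Prod>a \<leftarrow> map d [0..<m]. [:- a, 1:])" .
  have "Polynomial.order x (char_poly A) = sum_list (map (\<lambda>a. Polynomial.order x [:- a, 1:]) (map d [0..<m]))" for x
    unfolding cp by (subst order_prod_list) (auto simp: o_def)
  then have order: "Polynomial.order x (char_poly A) = (\<Sum>j<m. if d j = x then 1 else 0)" for x
  proof -
    have lin: "Polynomial.order x [:- a, 1:] = (if a = x then 1 else 0)" for a :: real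
      using order_linear'[of x "- a"] by auto
    have "Polynomial.order x (char_poly A)
        = sum_list (map (\<lambda>a. Polynomial.order x [:- a, 1:]) (map d [0..<m]))" by fact
    also have "\<dots> = sum_list (map (\<lambda>j. if d j = x then 1 else 0) [0..<m])"
      unfolding lin by (simp add: o_def)
    also have "\<dots> = (\<Sum>j<m. if d j = x then 1 else 0)"
      by (simp add: interv_sum_list_conv_sum_set_nat lessThan_atLeast0)
    finally show ?thesis .
  qed
  have ev: "eigenvalue A x \<longleftrightarrow> x \<in> d ` {..<m}" for x
    unfolding eigenvalue_root_char_poly[OF A] cp
    by (auto simp: poly_prod_list prod_list_zero_iff o_def)
  let ?S = "{x. x \<in> d ` {..<m} \<and> x < 0}"
  have "neg_inertia A = (\<Sum>x\<in>?S. \<Sum>j<m. if d j = x then 1 else 0)"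
    unfolding neg_inertia_def ev order ..
  also have "\<dots> = (\<Sum>j<m. \<Sum>x\<in>?S. if d j = x then 1 else 0)" by (rule sum.swap)
  also have "\<dots> = (\<Sum>j<m. if d j < 0 then 1 else 0)"
    by (intro sum.cong refl) (auto simp: sum.delta')
  also have "\<dots> = card {j. j < m \<and> d j < 0}"
    by (simp add: sum.If_cases Collect_conj_eq lessThan_def)
  finally show ?thesis .
qed

text \<open>The columns of \<open>P\<close> with index in \<open>J\<close> again diagonalise \<open>A\<close>. This provides bases of the
  negative eigenspace, the kernel, and the sum of the eigenspaces for nonzero eigenvalues.\<close>

lemma select_eigenvectors:
  fixes A :: "real mat"
  assumes A: "A \<in> carrier_mat m m" and P: "P \<in> carrier_mat m m" "P\<^sup>T * P = 1\<^sub>m m"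
    and AP: "A * P = P * mat_diag m d" and J: "J \<subseteq> {..<m}"
  obtains U e where "U \<in> carrier_mat m (card J)" "U\<^sup>T * U = 1\<^sub>m (card J)"
    "A * U = U * mat_diag (card J) e" "\<And>c. c < card J \<Longrightarrow> e c \<in> d ` J"
proof -
  have "finite J" using J finite_subset by blast
  then obtain f where f: "bij_betw f {..<card J} J"
    by (metis ex_bij_betw_nat_finite lessThan_atLeast0)
  have fJ: "f c \<in> J" if "c < card J" for c using f that by (auto simp: bij_betw_def)
  have fm: "f c < m" if "c < card J" for c using fJ[OF that] J by auto
  have finj: "f c = f c' \<longleftrightarrow> c = c'" if "c < card J" "c' < card J" for c c'
    using f that by (auto simp: bij_betw_def inj_on_def)
  define U where "U = mat m (card J) (\<lambda>(i,c). P $$ (i, f c))"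
  have U: "U \<in> carrier_mat m (card J)" unfolding U_def by auto
  have col: "col U c = col P (f c)" if "c < card J" for c
    using that fm[OF that] P(1) by (auto simp: U_def)
  have "U\<^sup>T * U = 1\<^sub>m (card J)"
  proof (rule eq_matI)
    fix a b assume ab: "a < dim_row (1\<^sub>m (card J) :: real mat)" "b < dim_col (1\<^sub>m (card J) :: real mat)"
    then have "(U\<^sup>T * U) $$ (a,b) = col P (f a) \<bullet> col P (f b)" using U col by simp
    also have "\<dots> = (P\<^sup>T * P) $$ (f a, f b)" using P(1) fm ab by simp
    finally show "(U\<^sup>T * U) $$ (a,b) = 1\<^sub>m (card J) $$ (a,b)"
      unfolding P(2) using ab fm finj by simp
  qed (use U in auto)
  moreover have "A * U = U * mat_diag (card J) (\<lambda>c. d (f c))"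
  proof (rule eq_matI)
    fix i c assume "i < dim_row (U * mat_diag (card J) (\<lambda>c. d (f c)))"
      and "c < dim_col (U * mat_diag (card J) (\<lambda>c. d (f c)))"
    then have ic: "i < m" "c < card J" using U by (auto simp: mat_diag_def)
    have "(A * U) $$ (i,c) = (A * P) $$ (i, f c)" using A U P(1) ic fm col by simp
    also have "\<dots> = (U * mat_diag (card J) (\<lambda>c. d (f c))) $$ (i,c)"
      unfolding AP mat_diag_mult_right[OF P(1)] mat_diag_mult_right[OF U]
      using ic fm by (simp add: U_def)
    finally show "(A * U) $$ (i,c) = (U * mat_diag (card J) (\<lambda>c. d (f c))) $$ (i,c)" .
  qed (use A U in \<open>auto simp: mat_diag_def\<close>)
  ultimately show ?thesis using that[OF U] fJ by blast
qed

lemma orthonormal_indep_cols: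
  fixes U :: "real mat"
  assumes U: "U \<in> carrier_mat m d" and "U\<^sup>T * U = 1\<^sub>m d"
  shows "indep_cols U"
proof (rule indep_colsI[OF U])
  fix v :: "real vec" assume v: "v \<in> carrier_vec d" "U *\<^sub>v v = 0\<^sub>v m"
  have "v = U\<^sup>T *\<^sub>v (U *\<^sub>v v)" using assoc_mult_mat_vec[of "U\<^sup>T" d m U d v] U v(1) assms(2) by simp
  then show "v = 0\<^sub>v d" unfolding v(2) using U by (auto simp: scalar_prod_def)
qed

lemma eigenvectors_form:
  fixes A U :: "real mat"
  assumes A: "A \<in> carrier_mat m m" and U: "U \<in> carrier_mat m k" "U\<^sup>T * U = 1\<^sub>m k"
    and AU: "A * U = U * mat_diag k e" and v: "v \<in> carrier_vec k"
  shows "A *\<^sub>v (U *\<^sub>v v) = U *\<^sub>v (mat_diag k e *\<^sub>v v)"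
    and "(U *\<^sub>v v) \<bullet> (A *\<^sub>v (U *\<^sub>v v)) = (\<Sum>c<k. e c * (v $ c)\<^sup>2)"
proof -
  have D: "mat_diag k e *\<^sub>v v = vec k (\<lambda>c. e c * v $ c)"
    by (rule mat_diag_mult_vec[OF v])
  show eq: "A *\<^sub>v (U *\<^sub>v v) = U *\<^sub>v (mat_diag k e *\<^sub>v v)"
    using assoc_mult_mat_vec[OF A U(1) v] assoc_mult_mat_vec[OF U(1) mat_diag_dim v] AU by simp
  have "(U *\<^sub>v v) \<bullet> (A *\<^sub>v (U *\<^sub>v v)) = v \<bullet> (U\<^sup>T *\<^sub>v (U *\<^sub>v (mat_diag k e *\<^sub>v v)))"
    unfolding eq by (rule inner_mult_mat_vec[OF U(1) v]) (use U D in auto)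
  also have "U\<^sup>T *\<^sub>v (U *\<^sub>v (mat_diag k e *\<^sub>v v)) = mat_diag k e *\<^sub>v v"
    using assoc_mult_mat_vec[of "U\<^sup>T" k m U k "mat_diag k e *\<^sub>v v"] U D by simp
  also have "v \<bullet> (mat_diag k e *\<^sub>v v) = (\<Sum>c<k. e c * (v $ c)\<^sup>2)"
    unfolding D using v
    by (auto simp: scalar_prod_def lessThan_atLeast0 power2_eq_square intro!: sum.cong)
  finally show "(U *\<^sub>v v) \<bullet> (A *\<^sub>v (U *\<^sub>v v)) = (\<Sum>c<k. e c * (v $ c)\<^sup>2)" .
qed

text \<open>The span of the eigenvectors with negative eigenvalue. Since the form is strictly
  negative on nonzero vectors, the columns of \<open>U\<close> are automatically independent.\<close>

lemma negative_definite_subspace: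
  fixes A :: "real mat"
  assumes A: "A \<in> carrier_mat m m" and sym: "A\<^sup>T = A"
  obtains U where "U \<in> carrier_mat m (neg_inertia A)"
    "\<And>v. v \<in> carrier_vec (neg_inertia A) \<Longrightarrow> v \<noteq> 0\<^sub>v (neg_inertia A)
      \<Longrightarrow> (U *\<^sub>v v) \<bullet> (A *\<^sub>v (U *\<^sub>v v)) < 0"
proof -
  obtain P d where P: "P \<in> carrier_mat m m" "P\<^sup>T * P = 1\<^sub>m m" "A * P = P * mat_diag m d"
    using real_symmetric_diagonalization[OF A sym] by blast
  let ?J = "{j. j < m \<and> d j < 0}"
  have J: "?J \<subseteq> {..<m}" by auto
  obtain U e where U: "U \<in> carrier_mat m (card ?J)" "U\<^sup>T * U = 1\<^sub>m (card ?J)"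
    "A * U = U * mat_diag (card ?J) e" "\<And>c. c < card ?J \<Longrightarrow> e c \<in> d ` ?J"
    using select_eigenvectors[OF A P J] by blast
  have "(U *\<^sub>v v) \<bullet> (A *\<^sub>v (U *\<^sub>v v)) < 0" if v: "v \<in> carrier_vec (card ?J)" "v \<noteq> 0\<^sub>v (card ?J)" for v
  proof -
    obtain c where c: "c < card ?J" "v $ c \<noteq> 0" using v by (metis carrier_vecD eq_vecI index_zero_vec)
    have neg: "e c < 0" if "c < card ?J" for c using U(4)[OF that] by auto
    have "(\<Sum>c<card ?J. - e c * (v $ c)\<^sup>2) > 0"
      using c neg by (intro sum_pos2[of _ c]) (auto simp: mult_less_0_iff mult_le_0_iff less_imp_le)
    then show ?thesis using eigenvectors_form(2)[OF A U(1-3) v(1)] by (simp add: sum_negf)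
  qed
  with U(1) that show ?thesis using neg_inertia_diagonalized[OF A P] by simp
qed

text \<open>The eigenvalues are negative, positive or zero. The zero ones are counted by the
  nullity: their eigenvectors lie in the kernel, and the kernel meets the span of the other
  eigenvectors only in \<open>0\<close>.\<close>

lemma inertia_sum:
  fixes A :: "real mat"
  assumes A: "A \<in> carrier_mat m m" and sym: "A\<^sup>T = A"
  shows "neg_inertia A + neg_inertia (- A) + kernel_dim A = m"
proof -
  obtain P d where P: "P \<in> carrier_mat m m" "P\<^sup>T * P = 1\<^sub>m m" "A * P = P * mat_diag m d"
    using real_symmetric_diagonalization[OF A sym] by blast
  let ?Z = "{j. j < m \<and> d j = 0}" and ?J = "{j. j < m \<and> d j \<noteq> 0}"
  have "(- A) * P = P * mat_diag m (\<lambda>j. - d j)"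
    using P(1,3) A unfolding mat_diag_mult_right[OF P(1)]
    by (simp add: uminus_mult_left_mat) (intro eq_matI, auto)
  then have neg: "neg_inertia (- A) = card {j. j < m \<and> d j > 0}"
    using neg_inertia_diagonalized[of "- A" m P "\<lambda>j. - d j"] A P by simp
  have pos: "neg_inertia A = card {j. j < m \<and> d j < 0}"
    by (rule neg_inertia_diagonalized[OF A P])
  have "?J = {j. j < m \<and> d j < 0} \<union> {j. j < m \<and> d j > 0}" by auto
  then have cardJ: "card ?J = neg_inertia A + neg_inertia (- A)"
    unfolding neg pos by (simp add: card_Un_disjoint disjoint_iff)
  have "{..<m} = ?J \<union> ?Z" by auto
  then have "card {..<m} = card ?J + card ?Z" by (simp only:) (intro card_Un_disjoint, auto)
  then have m: "m = card ?J + card ?Z" by simp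
  have "card ?Z \<le> kernel_dim A"
  proof -
    obtain U e where U: "U \<in> carrier_mat m (card ?Z)" "U\<^sup>T * U = 1\<^sub>m (card ?Z)"
      "A * U = U * mat_diag (card ?Z) e" "\<And>c. c < card ?Z \<Longrightarrow> e c \<in> d ` ?Z"
      using select_eigenvectors[OF A P, of ?Z] by blast
    have e0: "e c = 0" if "c < card ?Z" for c using U(4)[OF that] by auto
    have AU0: "A * U = 0\<^sub>m m (card ?Z)"
      unfolding U(3) mat_diag_mult_right[OF U(1)] by (rule eq_matI) (use e0 in auto)
    have "A *\<^sub>v (U *\<^sub>v v) = 0\<^sub>v m" if "v \<in> carrier_vec (card ?Z)" for v
      by (rule mult_mat_vec_zero[OF A U(1) AU0 that])
    then show ?thesis
      using indep_cols_le_kernel_dim[OF A U(1) orthonormal_indep_cols[OF U(1,2)]] by blast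
  qed
  moreover have "kernel_dim A + card ?J \<le> m"
  proof -
    obtain K where K: "K \<in> carrier_mat m (kernel_dim A)" "indep_cols K" "A * K = 0\<^sub>m m (kernel_dim A)"
      using kernel_basis_mat[OF A] .
    obtain U e where U: "U \<in> carrier_mat m (card ?J)" "U\<^sup>T * U = 1\<^sub>m (card ?J)"
      "A * U = U * mat_diag (card ?J) e" "\<And>c. c < card ?J \<Longrightarrow> e c \<in> d ` ?J"
      using select_eigenvectors[OF A P, of ?J] by blast
    have e0: "e c \<noteq> 0" if "c < card ?J" for c using U(4)[OF that] by auto
    have "indep_cols (hcat K U)"
    proof (rule indep_cols_hcat[OF K(1) U(1)])
      fix a b assume a: "a \<in> carrier_vec (kernel_dim A)" and b: "b \<in> carrier_vec (card ?J)"
        and 0: "K *\<^sub>v a + U *\<^sub>v b = 0\<^sub>v m"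
      have Ka: "K *\<^sub>v a \<in> carrier_vec m" and Ub: "U *\<^sub>v b \<in> carrier_vec m" using K U a b by auto
      let ?b = "mat_diag (card ?J) e *\<^sub>v b"
      have AKa: "A *\<^sub>v (K *\<^sub>v a) = 0\<^sub>v m" by (rule mult_mat_vec_zero[OF A K(1,3) a])
      have "A *\<^sub>v (K *\<^sub>v a + U *\<^sub>v b) = A *\<^sub>v (K *\<^sub>v a) + A *\<^sub>v (U *\<^sub>v b)"
        by (rule mult_add_distrib_mat_vec[OF A Ka Ub])
      moreover have "A *\<^sub>v 0\<^sub>v m = 0\<^sub>v m" using A by (intro eq_vecI) auto
      ultimately have "A *\<^sub>v (U *\<^sub>v b) = 0\<^sub>v m" unfolding 0 AKa using A Ub by simp
      then have "U *\<^sub>v ?b = 0\<^sub>v m" using eigenvectors_form(1)[OF A U(1-3) b] by simp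
      then have b_zero: "?b = 0\<^sub>v (card ?J)"
        using indep_colsD[OF orthonormal_indep_cols[OF U(1,2)] U(1), of ?b]
        by (simp add: mat_diag_mult_vec[OF b])
      have bc: "b $ c = 0" if c: "c < card ?J" for c
      proof -
        have "?b $ c = e c * b $ c" using c by (simp add: mat_diag_mult_vec[OF b])
        then have "e c * b $ c = 0" unfolding b_zero index_zero_vec(1)[OF c] by simp
        then show ?thesis using e0[OF c] unfolding mult_eq_0_iff by blast
      qed
      have b0: "b = 0\<^sub>v (card ?J)"
      proof (rule eq_vecI)
        fix c assume "c < dim_vec (0\<^sub>v (card ?J) :: real vec)"
        then have "c < card ?J" unfolding index_zero_vec(2) .
        then show "b $ c = 0\<^sub>v (card ?J) $ c" using bc[of c] index_zero_vec(1)[of c] by metis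
      qed (metis b carrier_vecD index_zero_vec(2))
      then have "K *\<^sub>v a = 0\<^sub>v m" using 0 Ka mult_mat_zero_vec[OF U(1)] by simp
      then show "a = 0\<^sub>v (kernel_dim A) \<and> b = 0\<^sub>v (card ?J)" using indep_colsD[OF K(2,1) a] b0 by simp
    qed
    then show ?thesis using indep_cols_le[OF hcat_carrier[OF K(1) U(1)]] by simp
  qed
  ultimately show ?thesis using m cardJ by simp
qed

section \<open>Semidefinite subspaces and kernels of products\<close>

lemma mult_mat_uminus_vec:
  fixes A :: "'a :: comm_ring_1 mat"
  assumes "A \<in> carrier_mat r c" "v \<in> carrier_vec c"
  shows "A *\<^sub>v (- v) = - (A *\<^sub>v v)"
  using assms by (intro eq_vecI) auto

lemma inner_self_zero:
  fixes v :: "real vec"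
  assumes "v \<in> carrier_vec m" "v \<bullet> v = 0"
  shows "v = 0\<^sub>v m"
  using inner_self_pos[OF assms(1)] assms(2) by fastforce

lemma uminus_mat_form:
  fixes A :: "real mat"
  assumes "A \<in> carrier_mat m c" "x \<in> carrier_vec c" "y \<in> carrier_vec m"
  shows "y \<bullet> ((- A) *\<^sub>v x) = - (y \<bullet> (A *\<^sub>v x))"
  using assms by simp

lemma form_swap:
  fixes A :: "real mat"
  assumes A: "A \<in> carrier_mat m m" and sym: "A\<^sup>T = A"
    and x: "x \<in> carrier_vec m" and y: "y \<in> carrier_vec m"
  shows "x \<bullet> (A *\<^sub>v y) = y \<bullet> (A *\<^sub>v x)"
proof -
  have "x \<bullet> (A *\<^sub>v y) = (A *\<^sub>v x) \<bullet> y" using inner_mult_mat_vec[OF A x y] sym by simp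
  also have "\<dots> = y \<bullet> (A *\<^sub>v x)" by (rule comm_scalar_prod) (use A x y in auto)
  finally show ?thesis .
qed

lemma form_add:
  fixes A :: "real mat"
  assumes A: "A \<in> carrier_mat m m" and sym: "A\<^sup>T = A"
    and x: "x \<in> carrier_vec m" and y: "y \<in> carrier_vec m"
  shows "(x + y) \<bullet> (A *\<^sub>v (x + y)) = x \<bullet> (A *\<^sub>v x) + 2 * (x \<bullet> (A *\<^sub>v y)) + y \<bullet> (A *\<^sub>v y)"
proof -
  have Ax: "A *\<^sub>v x \<in> carrier_vec m" "A *\<^sub>v y \<in> carrier_vec m" using A x y by auto
  have "(x + y) \<bullet> (A *\<^sub>v (x + y)) = x \<bullet> (A *\<^sub>v x) + x \<bullet> (A *\<^sub>v y) + (y \<bullet> (A *\<^sub>v x) + y \<bullet> (A *\<^sub>v y))"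
    unfolding mult_add_distrib_mat_vec[OF A x y]
    by (simp add: add_scalar_prod_distrib[OF x y] scalar_prod_add_distrib[OF x Ax]
        scalar_prod_add_distrib[OF y Ax] Ax)
  then show ?thesis using form_swap[OF A sym x y] by simp
qed

lemma add_vec_zero_eq_uminus:
  fixes x y :: "'a :: ab_group_add vec"
  assumes "x \<in> carrier_vec m" "y \<in> carrier_vec m" "x + y = 0\<^sub>v m"
  shows "x = - y"
proof (rule eq_vecI)
  fix i assume "i < dim_vec (- y)"
  then have "i < m" using assms by auto
  then show "x $ i = (- y) $ i"
    using arg_cong[OF assms(3), of "\<lambda>v. v $ i"] assms(1,2) by (simp add: eq_neg_iff_add_eq_0)
qed (use assms in auto)

text \<open>A nonpositive subspace meets a maximal positive definite one only in \<open>0\<close>, so its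
  dimension is at most \<open>m\<close> minus the positive index.\<close>

lemma nonpositive_subspace_dim_le:
  fixes A :: "real mat"
  assumes A: "A \<in> carrier_mat m m" and sym: "A\<^sup>T = A"
    and W: "W \<in> carrier_mat m d" and ind: "indep_cols W"
    and nonpos: "\<And>v. v \<in> carrier_vec d \<Longrightarrow> (W *\<^sub>v v) \<bullet> (A *\<^sub>v (W *\<^sub>v v)) \<le> 0"
  shows "d \<le> neg_inertia A + kernel_dim A"
proof -
  let ?p = "neg_inertia (- A)"
  have nA: "- A \<in> carrier_mat m m" "(- A)\<^sup>T = - A"
    using A sym by (auto simp: transpose_uminus)
  obtain V where V: "V \<in> carrier_mat m ?p"
    and neg: "\<And>v. v \<in> carrier_vec ?p \<Longrightarrow> v \<noteq> 0\<^sub>v ?p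
      \<Longrightarrow> (V *\<^sub>v v) \<bullet> ((- A) *\<^sub>v (V *\<^sub>v v)) < 0"
    using negative_definite_subspace[OF nA] by blast
  have "indep_cols (hcat W V)"
  proof (rule indep_cols_hcat[OF W V])
    fix a b assume a: "a \<in> carrier_vec d" and b: "b \<in> carrier_vec ?p"
      and 0: "W *\<^sub>v a + V *\<^sub>v b = 0\<^sub>v m"
    have Wa: "W *\<^sub>v a \<in> carrier_vec m" and Vb: "V *\<^sub>v b \<in> carrier_vec m" using W V a b by auto
    have "W *\<^sub>v a = - (V *\<^sub>v b)" by (rule add_vec_zero_eq_uminus[OF Wa Vb 0])
    then have "(W *\<^sub>v a) \<bullet> (A *\<^sub>v (W *\<^sub>v a)) = (V *\<^sub>v b) \<bullet> (A *\<^sub>v (V *\<^sub>v b))"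
      using A V mult_mat_uminus_vec[OF A Vb] by simp
    then have "\<not> (V *\<^sub>v b) \<bullet> ((- A) *\<^sub>v (V *\<^sub>v b)) < 0"
      using nonpos[OF a] uminus_mat_form[OF A Vb Vb] by simp
    then have b0: "b = 0\<^sub>v ?p" using neg[OF b] by blast
    then have "W *\<^sub>v a = 0\<^sub>v m" using 0 Wa mult_mat_zero_vec[OF V] by simp
    then show "a = 0\<^sub>v d \<and> b = 0\<^sub>v ?p" using indep_colsD[OF ind W a] b0 by simp
  qed
  then have "d + ?p \<le> m" using indep_cols_le[OF hcat_carrier[OF W V]] by simp
  then show ?thesis using inertia_sum[OF A sym] by simp
qed

text \<open>Rank and nullity in matrix form. The form of the Gram matrix \<open>M\<^sup>t M\<close> is
  \<open>x \<mapsto> |M x|\<^sup>2\<close>, so its negative index is \<open>0\<close>, its kernel is that of \<open>M\<close>, and its positive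
  definite subspace is a complement on which \<open>M\<close> is injective.\<close>

lemma kernel_complement:
  fixes M :: "real mat"
  assumes M: "M \<in> carrier_mat r c"
  obtains C k where "C \<in> carrier_mat c k" "c \<le> k + kernel_dim M"
    "\<And>v. v \<in> carrier_vec k \<Longrightarrow> M *\<^sub>v (C *\<^sub>v v) = 0\<^sub>v r \<Longrightarrow> v = 0\<^sub>v k"
proof -
  define G where "G = M\<^sup>T * M"
  have G: "G \<in> carrier_mat c c" using M unfolding G_def by auto
  have Gsym: "G\<^sup>T = G" unfolding G_def using M transpose_mult[of "M\<^sup>T" c r M c] by simp
  have nG: "- G \<in> carrier_mat c c" "(- G)\<^sup>T = - G" using G Gsym by (auto simp: transpose_uminus)
  have form: "x \<bullet> (G *\<^sub>v x) = (M *\<^sub>v x) \<bullet> (M *\<^sub>v x)" if x: "x \<in> carrier_vec c" for x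
  proof -
    have "G *\<^sub>v x = M\<^sup>T *\<^sub>v (M *\<^sub>v x)"
      unfolding G_def using assoc_mult_mat_vec[of "M\<^sup>T" c r M c x] M x by simp
    then show ?thesis using inner_mult_mat_vec[OF M x, of "M *\<^sub>v x"] M x by simp
  qed
  have sq: "(y \<bullet> y :: real) \<ge> 0" for y by (simp add: scalar_prod_def sum_nonneg)
  have "neg_inertia G = 0"
  proof (rule ccontr)
    assume pos: "neg_inertia G \<noteq> 0"
    obtain U where U: "U \<in> carrier_mat c (neg_inertia G)"
      and neg: "\<And>v. v \<in> carrier_vec (neg_inertia G) \<Longrightarrow> v \<noteq> 0\<^sub>v (neg_inertia G)
        \<Longrightarrow> (U *\<^sub>v v) \<bullet> (G *\<^sub>v (U *\<^sub>v v)) < 0"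
      using negative_definite_subspace[OF G Gsym] by blast
    let ?v = "unit_vec (neg_inertia G) 0 :: real vec"
    have "?v $ 0 \<noteq> 0\<^sub>v (neg_inertia G) $ 0" using pos by simp
    then have "?v \<noteq> 0\<^sub>v (neg_inertia G)" by metis
    then have "(U *\<^sub>v ?v) \<bullet> (G *\<^sub>v (U *\<^sub>v ?v)) < 0" using neg by simp
    moreover have "U *\<^sub>v ?v \<in> carrier_vec c" using U by auto
    ultimately show False using form[of "U *\<^sub>v ?v"] sq by (metis not_less)
  qed
  moreover have "kernel_dim G \<le> kernel_dim M"
  proof -
    obtain K where K: "K \<in> carrier_mat c (kernel_dim G)" "indep_cols K" "G * K = 0\<^sub>m c (kernel_dim G)"
      using kernel_basis_mat[OF G] .
    have "M *\<^sub>v (K *\<^sub>v v) = 0\<^sub>v r" if v: "v \<in> carrier_vec (kernel_dim G)" for v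
    proof (rule inner_self_zero)
      have Kv: "K *\<^sub>v v \<in> carrier_vec c" using K v by auto
      show "M *\<^sub>v (K *\<^sub>v v) \<in> carrier_vec r" using M Kv by auto
      show "(M *\<^sub>v (K *\<^sub>v v)) \<bullet> (M *\<^sub>v (K *\<^sub>v v)) = 0"
        using form[OF Kv] mult_mat_vec_zero[OF G K(1,3) v] Kv by simp
    qed
    then show ?thesis using indep_cols_le_kernel_dim[OF M K(1,2)] by blast
  qed
  ultimately have dims: "c \<le> neg_inertia (- G) + kernel_dim M" using inertia_sum[OF G Gsym] by simp
  obtain C where C: "C \<in> carrier_mat c (neg_inertia (- G))"
    and neg: "\<And>v. v \<in> carrier_vec (neg_inertia (- G)) \<Longrightarrow> v \<noteq> 0\<^sub>v (neg_inertia (- G))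
        \<Longrightarrow> (C *\<^sub>v v) \<bullet> ((- G) *\<^sub>v (C *\<^sub>v v)) < 0"
    using negative_definite_subspace[OF nG] by blast
  have "v = 0\<^sub>v (neg_inertia (- G))"
    if v: "v \<in> carrier_vec (neg_inertia (- G))" and 0: "M *\<^sub>v (C *\<^sub>v v) = 0\<^sub>v r" for v
  proof (rule ccontr)
    assume "v \<noteq> 0\<^sub>v (neg_inertia (- G))"
    moreover have Cv: "C *\<^sub>v v \<in> carrier_vec c" using C v by auto
    ultimately show False
      using neg[OF v] uminus_mat_form[OF G Cv Cv] form[OF Cv] unfolding 0 by simp
  qed
  with that C dims show ?thesis by blast
qed

text \<open>With \<open>K\<close> a basis of the kernel of \<open>A\<^sup>t B\<close>, the image of \<open>B K\<close> lies in the kernel of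
  \<open>A\<^sup>t\<close>, hence is orthogonal to the image of \<open>A\<close>; so the ranks of \<open>B K\<close> and \<open>A\<close> add up to at most \<open>n\<close>,
  while passing from \<open>K\<close> to \<open>B K\<close> loses at most the nullity of \<open>B\<close>.\<close>

lemma kernel_dim_transpose_mult_le:
  fixes A B :: "real mat"
  assumes A: "A \<in> carrier_mat n n" and B: "B \<in> carrier_mat n n"
  shows "kernel_dim (A\<^sup>T * B) \<le> kernel_dim A + kernel_dim B"
proof -
  let ?z = "kernel_dim (A\<^sup>T * B)"
  have AB: "A\<^sup>T * B \<in> carrier_mat n n" using A B by auto
  obtain K where K: "K \<in> carrier_mat n ?z" "indep_cols K" "A\<^sup>T * B * K = 0\<^sub>m n ?z"
    using kernel_basis_mat[OF AB] .
  define M where "M = B * K"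
  have M: "M \<in> carrier_mat n ?z" using B K unfolding M_def by auto
  have Mv: "M *\<^sub>v v = B *\<^sub>v (K *\<^sub>v v)" if "v \<in> carrier_vec ?z" for v
    unfolding M_def by (rule assoc_mult_mat_vec[OF B K(1) that])
  have ATM: "A\<^sup>T *\<^sub>v (M *\<^sub>v v) = 0\<^sub>v n" if v: "v \<in> carrier_vec ?z" for v
  proof -
    have "A\<^sup>T *\<^sub>v (M *\<^sub>v v) = (A\<^sup>T * B) *\<^sub>v (K *\<^sub>v v)"
      unfolding Mv[OF v] using assoc_mult_mat_vec[of "A\<^sup>T" n n B n "K *\<^sub>v v"] A B K v by simp
    then show ?thesis using mult_mat_vec_zero[OF AB K(1,3) v] by simp
  qed
  have kM: "kernel_dim M \<le> kernel_dim B"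
  proof -
    obtain L where L: "L \<in> carrier_mat ?z (kernel_dim M)" "indep_cols L" "M * L = 0\<^sub>m n (kernel_dim M)"
      using kernel_basis_mat[OF M] .
    have KL: "K * L \<in> carrier_mat n (kernel_dim M)" using K L by auto
    have KLv: "(K * L) *\<^sub>v v = K *\<^sub>v (L *\<^sub>v v)" if "v \<in> carrier_vec (kernel_dim M)" for v
      by (rule assoc_mult_mat_vec[OF K(1) L(1) that])
    have "indep_cols (K * L)"
    proof (rule indep_colsI[OF KL])
      fix v assume v: "v \<in> carrier_vec (kernel_dim M)" "(K * L) *\<^sub>v v = 0\<^sub>v n"
      then have "L *\<^sub>v v = 0\<^sub>v ?z" using KLv indep_colsD[OF K(2,1)] L(1) by auto
      then show "v = 0\<^sub>v (kernel_dim M)" by (rule indep_colsD[OF L(2,1) v(1)])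
    qed
    moreover have "B *\<^sub>v ((K * L) *\<^sub>v v) = 0\<^sub>v n" if v: "v \<in> carrier_vec (kernel_dim M)" for v
      using mult_mat_vec_zero[OF M L(1,3) v] Mv[of "L *\<^sub>v v"] KLv[OF v] L(1) v by simp
    ultimately show ?thesis by (rule indep_cols_le_kernel_dim[OF B KL])
  qed
  obtain C k where C: "C \<in> carrier_mat ?z k" "?z \<le> k + kernel_dim M"
    "\<And>v. v \<in> carrier_vec k \<Longrightarrow> M *\<^sub>v (C *\<^sub>v v) = 0\<^sub>v n \<Longrightarrow> v = 0\<^sub>v k"
    using kernel_complement[OF M] by blast
  obtain D l where D: "D \<in> carrier_mat n l" "n \<le> l + kernel_dim A"
    "\<And>v. v \<in> carrier_vec l \<Longrightarrow> A *\<^sub>v (D *\<^sub>v v) = 0\<^sub>v n \<Longrightarrow> v = 0\<^sub>v l"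
    using kernel_complement[OF A] by blast
  have MC: "M * C \<in> carrier_mat n k" and AD: "A * D \<in> carrier_mat n l" using M C A D by auto
  have "indep_cols (hcat (A * D) (M * C))"
  proof (rule indep_cols_hcat[OF AD MC])
    fix u v assume u: "u \<in> carrier_vec l" and v: "v \<in> carrier_vec k"
      and 0: "(A * D) *\<^sub>v u + (M * C) *\<^sub>v v = 0\<^sub>v n"
    define x where "x = A *\<^sub>v (D *\<^sub>v u)"
    define y where "y = M *\<^sub>v (C *\<^sub>v v)"
    have x: "x \<in> carrier_vec n" and y: "y \<in> carrier_vec n"
      unfolding x_def y_def using A D M C u v by auto
    have xy: "x + y = 0\<^sub>v n"
      using 0 unfolding x_def y_def
      by (simp add: assoc_mult_mat_vec[OF A D(1) u] assoc_mult_mat_vec[OF M C(1) v])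
    have "x \<bullet> y = (D *\<^sub>v u) \<bullet> (A\<^sup>T *\<^sub>v y)"
      unfolding x_def by (rule inner_mult_mat_vec[OF A]) (use D u y in auto)
    also have "\<dots> = 0" unfolding y_def using ATM[of "C *\<^sub>v v"] C D u v by simp
    finally have ortho: "x \<bullet> y = 0" .
    have "x \<bullet> (x + y) = x \<bullet> x + x \<bullet> y" by (rule scalar_prod_add_distrib[OF x x y])
    then have "x \<bullet> x = 0" using ortho x unfolding xy by simp
    then have x0: "x = 0\<^sub>v n" by (rule inner_self_zero[OF x])
    then have "y = 0\<^sub>v n" using xy y by simp
    with x0 show "u = 0\<^sub>v l \<and> v = 0\<^sub>v k" using D(3)[OF u] C(3)[OF v] unfolding x_def y_def by simp
  qed
  then have "l + k \<le> n" using indep_cols_le[OF hcat_carrier[OF AD MC]] by simp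
  then show ?thesis using C(2) D(2) kM by simp
qed

section \<open>Orthogonal flags\<close>

text \<open>The part of the structure that the index formula uses. Vectors vanishing from
  coordinate \<open>n * k\<close> on form a flag \<open>F\<^sub>0 \<subseteq> F\<^sub>1 \<subseteq> \<dots>\<close>; \<open>W k\<close> maps into \<open>F\<^sub>k\<close> and is \<open>T\<close>-orthogonal to \<open>F\<^sub>k\<^sub>-\<^sub>1\<close>,
  \<open>Q k\<close> is the form induced on it, and the kernel of \<open>Y k\<close> contains every \<open>v\<close> for which \<open>W k *\<^sub>v v\<close>
  already lies in \<open>F\<^sub>k\<^sub>-\<^sub>1\<close>. The conditions are invariant under changing the sign of \<open>T\<close> and \<open>Q\<close>, which
  turns each bound for the negative index into one for the positive index.\<close>

locale orthogonal_flag =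
  fixes n N :: nat and T :: "real mat" and W Q Y :: "nat \<Rightarrow> real mat"
  assumes T: "T \<in> carrier_mat (n * N) (n * N)" and T_sym: "T\<^sup>T = T"
    and W: "k \<in> {1..N} \<Longrightarrow> W k \<in> carrier_mat (n * N) n"
    and Y: "k \<in> {1..N+1} \<Longrightarrow> Y k \<in> carrier_mat n n"
    and Q: "k \<in> {1..N} \<Longrightarrow> Q k \<in> carrier_mat n n"
    and Q_sym: "k \<in> {1..N} \<Longrightarrow> (Q k)\<^sup>T = Q k"
    and form: "k \<in> {1..N} \<Longrightarrow> v \<in> carrier_vec n
      \<Longrightarrow> (W k *\<^sub>v v) \<bullet> (T *\<^sub>v (W k *\<^sub>v v)) = v \<bullet> (Q k *\<^sub>v v)"
    and supp: "k \<in> {1..N} \<Longrightarrow> v \<in> carrier_vec n \<Longrightarrow> n * k \<le> i \<Longrightarrow> i < n * N \<Longrightarrow> (W k *\<^sub>v v) $ i = 0"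
    and orth: "k \<in> {1..N} \<Longrightarrow> v \<in> carrier_vec n \<Longrightarrow> x \<in> carrier_vec (n * N)
      \<Longrightarrow> (\<And>i. n * (k - 1) \<le> i \<Longrightarrow> i < n * N \<Longrightarrow> x $ i = 0) \<Longrightarrow> x \<bullet> (T *\<^sub>v (W k *\<^sub>v v)) = 0"
    and last_block: "k \<in> {1..N} \<Longrightarrow> v \<in> carrier_vec n
      \<Longrightarrow> (\<And>i. n * (k - 1) \<le> i \<Longrightarrow> i < n * N \<Longrightarrow> (W k *\<^sub>v v) $ i = 0) \<Longrightarrow> Y k *\<^sub>v v = 0\<^sub>v n"
    and Q_zero: "k \<in> {1..N} \<Longrightarrow> v \<in> carrier_vec n \<Longrightarrow> Y (k + 1) *\<^sub>v v = 0\<^sub>v n \<Longrightarrow> Q k *\<^sub>v v = 0\<^sub>v n"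
    and joint: "k \<in> {1..N} \<Longrightarrow> v \<in> carrier_vec n \<Longrightarrow> Y k *\<^sub>v v = 0\<^sub>v n \<Longrightarrow> Y (k + 1) *\<^sub>v v = 0\<^sub>v n \<Longrightarrow> v = 0\<^sub>v n"
    and start: "kernel_dim (Y 1) = 0"
begin

lemma negated: "orthogonal_flag n N (- T) W (\<lambda>k. - Q k) Y"
proof (unfold_locales)
  fix k and v x :: "real vec" assume k: "k \<in> {1..N}" and v: "v \<in> carrier_vec n"
  have Wv: "W k *\<^sub>v v \<in> carrier_vec (n * N)" using W[OF k] v by auto
  show "(W k *\<^sub>v v) \<bullet> (- T *\<^sub>v (W k *\<^sub>v v)) = v \<bullet> (- Q k *\<^sub>v v)"
    using uminus_mat_form[OF T Wv Wv] uminus_mat_form[OF Q[OF k] v v] form[OF k v] by simp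
  show "x \<bullet> (- T *\<^sub>v (W k *\<^sub>v v)) = 0"
    if "x \<in> carrier_vec (n * N)" "\<And>i. n * (k - 1) \<le> i \<Longrightarrow> i < n * N \<Longrightarrow> x $ i = 0"
    using uminus_mat_form[OF T Wv that(1)] orth[OF k v that] by simp
  show "- Q k *\<^sub>v v = 0\<^sub>v n" if "Y (k + 1) *\<^sub>v v = 0\<^sub>v n"
    using Q_zero[OF k v that] Q[OF k] v by (simp add: uminus_mult_mat_vec)
qed (use T T_sym W Y Q Q_sym supp last_block joint start in \<open>auto simp: transpose_uminus\<close>)

definition nonpositive_basis :: "nat \<Rightarrow> nat \<Rightarrow> real mat \<Rightarrow> bool" where
  "nonpositive_basis k d U \<longleftrightarrow> U \<in> carrier_mat (n * N) d \<and> indep_cols U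
    \<and> (\<forall>a \<in> carrier_vec d. \<forall>i. n * k \<le> i \<longrightarrow> i < n * N \<longrightarrow> (U *\<^sub>v a) $ i = 0)
    \<and> (\<forall>a \<in> carrier_vec d. (U *\<^sub>v a) \<bullet> (T *\<^sub>v (U *\<^sub>v a)) \<le> 0)"

text \<open>The new directions are \<open>W k *\<^sub>v g\<close>, with \<open>g\<close> in a maximal negative subspace of \<open>Q k\<close>
  (basis \<open>V\<close>) plus the kernel of \<open>Y (k + 1)\<close> (basis \<open>K\<close>). They are orthogonal to \<open>F\<^sub>k\<^sub>-\<^sub>1\<close>, and \<open>Q k\<close>
  vanishes on the kernel part, so the form stays nonpositive. In a vanishing combination the form
  kills the negative part; then \<open>W k *\<^sub>v (K *\<^sub>v c)\<close> lies in \<open>F\<^sub>k\<^sub>-\<^sub>1\<close>, so \<open>K *\<^sub>v c\<close> is in the kernels of both \<open>Y k\<close>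
  and \<open>Y (k + 1)\<close> and must be \<open>0\<close>.\<close>

lemma extend_nonpositive_basis:
  assumes k: "k \<in> {1..N}" and basis: "nonpositive_basis (k - 1) d U"
  obtains U' where "nonpositive_basis k (d + (neg_inertia (Q k) + kernel_dim (Y (k + 1)))) U'"
proof -
  have U: "U \<in> carrier_mat (n * N) d" "indep_cols U"
    and U_supp: "\<And>a i. a \<in> carrier_vec d \<Longrightarrow> n * (k - 1) \<le> i \<Longrightarrow> i < n * N \<Longrightarrow> (U *\<^sub>v a) $ i = 0"
    and U_nonpos: "\<And>a. a \<in> carrier_vec d \<Longrightarrow> (U *\<^sub>v a) \<bullet> (T *\<^sub>v (U *\<^sub>v a)) \<le> 0"
    using basis unfolding nonpositive_basis_def by auto
  let ?q = "neg_inertia (Q k)" and ?z = "kernel_dim (Y (k + 1))"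
  have k1: "k + 1 \<in> {1..N+1}" using k by auto
  obtain V where V: "V \<in> carrier_mat n ?q"
    and V_neg: "\<And>b. b \<in> carrier_vec ?q \<Longrightarrow> b \<noteq> 0\<^sub>v ?q \<Longrightarrow> (V *\<^sub>v b) \<bullet> (Q k *\<^sub>v (V *\<^sub>v b)) < 0"
    using negative_definite_subspace[OF Q[OF k] Q_sym[OF k]] by blast
  obtain K where K: "K \<in> carrier_mat n ?z" "indep_cols K" "Y (k + 1) * K = 0\<^sub>m n ?z"
    using kernel_basis_mat[OF Y[OF k1]] .
  have YK: "Y (k + 1) *\<^sub>v (K *\<^sub>v c) = 0\<^sub>v n" if "c \<in> carrier_vec ?z" for c
    by (rule mult_mat_vec_zero[OF Y[OF k1] K(1,3) that])
  define G where "G = W k * hcat V K"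
  have VK: "hcat V K \<in> carrier_mat n (?q + ?z)" by (rule hcat_carrier[OF V K(1)])
  have G: "G \<in> carrier_mat (n * N) (?q + ?z)" unfolding G_def using W[OF k] VK by auto
  have Gv: "G *\<^sub>v (b @\<^sub>v c) = W k *\<^sub>v (V *\<^sub>v b + K *\<^sub>v c)"
    if "b \<in> carrier_vec ?q" "c \<in> carrier_vec ?z" for b c
    unfolding G_def using that
    by (simp add: assoc_mult_mat_vec[OF W[OF k] VK] hcat_mult_vec[OF V K(1)])
  have Q_split: "(V *\<^sub>v b + K *\<^sub>v c) \<bullet> (Q k *\<^sub>v (V *\<^sub>v b + K *\<^sub>v c)) = (V *\<^sub>v b) \<bullet> (Q k *\<^sub>v (V *\<^sub>v b))"
    if b: "b \<in> carrier_vec ?q" and c: "c \<in> carrier_vec ?z" for b c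
  proof -
    have Vb: "V *\<^sub>v b \<in> carrier_vec n" and Kc: "K *\<^sub>v c \<in> carrier_vec n" using V K b c by auto
    have "Q k *\<^sub>v (K *\<^sub>v c) = 0\<^sub>v n" by (rule Q_zero[OF k Kc YK[OF c]])
    then show ?thesis using form_add[OF Q[OF k] Q_sym[OF k] Vb Kc] Vb Kc by simp
  qed
  have cross: "(U *\<^sub>v u) \<bullet> (T *\<^sub>v (W k *\<^sub>v g)) = 0"
    if u: "u \<in> carrier_vec d" and g: "g \<in> carrier_vec n" for u g
    by (rule orth[OF k g]) (use U(1) u U_supp[OF u] in auto)
  have V_nonpos: "(V *\<^sub>v b) \<bullet> (Q k *\<^sub>v (V *\<^sub>v b)) \<le> 0" if b: "b \<in> carrier_vec ?q" for b
  proof (cases "b = 0\<^sub>v ?q")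
    case True
    then show ?thesis
      using mult_mat_zero_vec[OF V] mult_mat_zero_vec[OF Q[OF k]] by simp
  next
    case False
    then show ?thesis using V_neg[OF b] by simp
  qed
  let ?U' = "hcat U G"
  have U': "?U' \<in> carrier_mat (n * N) (d + (?q + ?z))" by (rule hcat_carrier[OF U(1) G])
  have "indep_cols ?U'"
  proof (rule indep_cols_hcat[OF U(1) G])
    fix u v assume u: "u \<in> carrier_vec d" and v: "v \<in> carrier_vec (?q + ?z)"
      and 0: "U *\<^sub>v u + G *\<^sub>v v = 0\<^sub>v (n * N)"
    obtain b c where bc: "b \<in> carrier_vec ?q" "c \<in> carrier_vec ?z" "v = b @\<^sub>v c" using split_vec[OF v] .
    define x where "x = U *\<^sub>v u"
    define g where "g = V *\<^sub>v b + K *\<^sub>v c"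
    define y where "y = W k *\<^sub>v g"
    have g: "g \<in> carrier_vec n" unfolding g_def using V K bc by auto
    have y: "y \<in> carrier_vec (n * N)" unfolding y_def using W[OF k] g by auto
    have x: "x \<in> carrier_vec (n * N)" unfolding x_def using U u by auto
    have xy: "x + y = 0\<^sub>v (n * N)" using 0 Gv[OF bc(1,2)] unfolding x_def y_def g_def bc(3) by simp
    have yx: "y + x = 0\<^sub>v (n * N)" using xy comm_add_vec[OF x y] by simp
    have xTy: "x \<bullet> (T *\<^sub>v y) = 0" unfolding y_def x_def by (rule cross[OF u g])
    have "T *\<^sub>v y \<in> carrier_vec (n * N)" using T y by auto
    then have "(x + y) \<bullet> (T *\<^sub>v y) = x \<bullet> (T *\<^sub>v y) + y \<bullet> (T *\<^sub>v y)"
      by (rule add_scalar_prod_distrib[OF x y])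
    then have "y \<bullet> (T *\<^sub>v y) = 0" using xTy T y unfolding xy by simp
    then have "(V *\<^sub>v b) \<bullet> (Q k *\<^sub>v (V *\<^sub>v b)) = 0"
      using form[OF k g] Q_split[OF bc(1,2)] unfolding y_def g_def by simp
    then have b0: "b = 0\<^sub>v ?q" using V_neg[OF bc(1)] by fastforce
    have Kc: "K *\<^sub>v c \<in> carrier_vec n" using K bc by auto
    have gK: "g = K *\<^sub>v c" unfolding g_def b0 mult_mat_zero_vec[OF V] using Kc by simp
    have yi: "y $ i = 0" if i: "n * (k - 1) \<le> i" "i < n * N" for i
    proof -
      have "(y + x) $ i = y $ i + x $ i" by (rule index_add_vec(1)) (use x i in simp)
      then show ?thesis unfolding yx using U_supp[OF u i] i by (simp add: x_def)
    qed
    have "Y k *\<^sub>v (K *\<^sub>v c) = 0\<^sub>v n"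
      using last_block[OF k g] yi unfolding y_def gK by blast
    then have "K *\<^sub>v c = 0\<^sub>v n" using joint[OF k Kc _ YK[OF bc(2)]] by blast
    then have c0: "c = 0\<^sub>v ?z" and "g = 0\<^sub>v n" using indep_colsD[OF K(2,1) bc(2)] gK by auto
    then have "y = 0\<^sub>v (n * N)" unfolding y_def using mult_mat_zero_vec[OF W[OF k]] by simp
    then have "x = 0\<^sub>v (n * N)" using xy x by simp
    then have "u = 0\<^sub>v d" using indep_colsD[OF U(2,1) u] unfolding x_def by simp
    then show "u = 0\<^sub>v d \<and> v = 0\<^sub>v (?q + ?z)" using b0 c0 bc(3) by auto
  qed
  moreover have "(?U' *\<^sub>v a) $ i = 0"
    if a: "a \<in> carrier_vec (d + (?q + ?z))" and i: "n * k \<le> i" "i < n * N" for a i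
  proof -
    obtain u v where uv: "u \<in> carrier_vec d" "v \<in> carrier_vec (?q + ?z)" "a = u @\<^sub>v v"
      using split_vec[OF a] .
    obtain b c where bc: "b \<in> carrier_vec ?q" "c \<in> carrier_vec ?z" "v = b @\<^sub>v c"
      using split_vec[OF uv(2)] .
    have g: "V *\<^sub>v b + K *\<^sub>v c \<in> carrier_vec n" using V K bc by auto
    have "n * (k - 1) \<le> i" using i(1) by (meson diff_le_self le_trans mult_le_mono2)
    then have "(U *\<^sub>v u) $ i = 0" using U_supp[OF uv(1)] i(2) by blast
    moreover have "(W k *\<^sub>v (V *\<^sub>v b + K *\<^sub>v c)) $ i = 0" by (rule supp[OF k g i])
    moreover have "?U' *\<^sub>v a = U *\<^sub>v u + W k *\<^sub>v (V *\<^sub>v b + K *\<^sub>v c)"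
      using hcat_mult_vec[OF U(1) G uv(1,2)] Gv[OF bc(1,2)] uv(3) bc(3) by simp
    ultimately show ?thesis using i(2) W[OF k] by simp
  qed
  moreover have "(?U' *\<^sub>v a) \<bullet> (T *\<^sub>v (?U' *\<^sub>v a)) \<le> 0"
    if a: "a \<in> carrier_vec (d + (?q + ?z))" for a
  proof -
    obtain u v where uv: "u \<in> carrier_vec d" "v \<in> carrier_vec (?q + ?z)" "a = u @\<^sub>v v"
      using split_vec[OF a] .
    obtain b c where bc: "b \<in> carrier_vec ?q" "c \<in> carrier_vec ?z" "v = b @\<^sub>v c"
      using split_vec[OF uv(2)] .
    have g: "V *\<^sub>v b + K *\<^sub>v c \<in> carrier_vec n" using V K bc by auto
    have x: "U *\<^sub>v u \<in> carrier_vec (n * N)" and y: "W k *\<^sub>v (V *\<^sub>v b + K *\<^sub>v c) \<in> carrier_vec (n * N)"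
      using U(1) uv(1) W[OF k] g by auto
    have "?U' *\<^sub>v a = U *\<^sub>v u + W k *\<^sub>v (V *\<^sub>v b + K *\<^sub>v c)"
      using hcat_mult_vec[OF U(1) G uv(1,2)] Gv[OF bc(1,2)] uv(3) bc(3) by simp
    then have "(?U' *\<^sub>v a) \<bullet> (T *\<^sub>v (?U' *\<^sub>v a))
        = (U *\<^sub>v u) \<bullet> (T *\<^sub>v (U *\<^sub>v u)) + (V *\<^sub>v b) \<bullet> (Q k *\<^sub>v (V *\<^sub>v b))"
      using form_add[OF T T_sym x y] cross[OF uv(1) g] form[OF k g] Q_split[OF bc(1,2)] by simp
    then show ?thesis using U_nonpos[OF uv(1)] V_nonpos[OF bc(1)] by simp
  qed
  ultimately have "nonpositive_basis k (d + (?q + ?z)) ?U'"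
    using U' unfolding nonpositive_basis_def by blast
  then show ?thesis by (rule that)
qed

text \<open>The contributions are regrouped: step \<open>k\<close> contributes the negative index of \<open>Q k\<close> and the
  nullity of \<open>Y (k + 1)\<close>, which at the following step is the nullity that belongs to \<open>Q (k + 1)\<close>.\<close>

lemma nonpositive_basis_exists:
  assumes "k \<le> N"
  shows "\<exists>U. nonpositive_basis k
    ((\<Sum>j=1..k. neg_inertia (Q j) + kernel_dim (Y j)) + kernel_dim (Y (k + 1))) U"
  using assms
proof (induction k)
  case 0
  let ?U = "0\<^sub>m (n * N) 0 :: real mat"
  have "?U *\<^sub>v a = 0\<^sub>v (n * N)" if "a \<in> carrier_vec 0" for a
    using that by (intro eq_vecI) (auto simp: scalar_prod_def)
  moreover have "indep_cols ?U" by (auto simp: indep_cols_def)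
  ultimately have "nonpositive_basis 0 0 ?U"
    using mult_mat_zero_vec[OF T] unfolding nonpositive_basis_def by simp
  then show ?case using start by auto
next
  case (Suc k)
  let ?d = "(\<Sum>j=1..k. neg_inertia (Q j) + kernel_dim (Y j)) + kernel_dim (Y (k + 1))"
  have k: "Suc k \<in> {1..N}" using Suc.prems by auto
  obtain U where "nonpositive_basis k ?d U" using Suc by auto
  then have "nonpositive_basis (Suc k - 1) ?d U" by simp
  then obtain U'
    where "nonpositive_basis (Suc k) (?d + (neg_inertia (Q (Suc k)) + kernel_dim (Y (Suc k + 1)))) U'"
    using extend_nonpositive_basis[OF k] by blast
  moreover have "?d + (neg_inertia (Q (Suc k)) + kernel_dim (Y (Suc k + 1)))
      = (\<Sum>j=1..Suc k. neg_inertia (Q j) + kernel_dim (Y j)) + kernel_dim (Y (Suc k + 1))"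
    by simp
  ultimately show ?case by metis
qed

lemma flag_dim_le:
  "(\<Sum>k=1..N. neg_inertia (Q k) + kernel_dim (Y k)) + kernel_dim (Y (N + 1))
    \<le> neg_inertia T + kernel_dim T"
proof -
  obtain U where "nonpositive_basis N
      ((\<Sum>k=1..N. neg_inertia (Q k) + kernel_dim (Y k)) + kernel_dim (Y (N + 1))) U"
    using nonpositive_basis_exists[of N] by blast
  then show ?thesis
    unfolding nonpositive_basis_def using nonpositive_subspace_dim_le[OF T T_sym] by blast
qed

text \<open>Add \<open>flag_dim_le\<close> to its negated version and write \<open>z\<close> for the nullity of \<open>Y (N + 1)\<close>.
  By \<open>inertia_sum\<close> the right-hand side is \<open>n * N\<close> plus the nullity of \<open>T\<close>, at most \<open>n * N + z\<close> by
  \<open>kerT\<close>; by \<open>inertia_sum\<close> for the \<open>Q k\<close> and \<open>kerQ\<close> the left-hand side is at least \<open>n * N + z\<close>. So neither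
  of the two inequalities is strict.\<close>

theorem neg_inertia_eq:
  assumes kerT: "kernel_dim T \<le> kernel_dim (Y (N + 1))"
    and kerQ: "\<And>k. k \<in> {1..N} \<Longrightarrow> kernel_dim (Q k) \<le> kernel_dim (Y k) + kernel_dim (Y (k + 1))"
  shows "neg_inertia T = (\<Sum>k=1..N. neg_inertia (Q k) + kernel_dim (Y k))"
proof -
  interpret neg: orthogonal_flag n N "- T" W "\<lambda>k. - Q k" Y by (rule negated)
  let ?z = "\<lambda>k. kernel_dim (Y k)"
  \<comment> \<open>Reindexing costs nothing at the lower end because the kernel of \<open>Y 1\<close> is trivial.\<close>
  have shift: "(\<Sum>k=1..N. ?z (k + 1)) = (\<Sum>k=1..N. ?z k) + ?z (N + 1)"
  proof -
    have "(\<Sum>k=1..M. ?z (k + 1)) + ?z 1 = (\<Sum>k=1..M. ?z k) + ?z (M + 1)" for M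
      by (induction M) auto
    then show ?thesis using start by simp
  qed
  have kT: "kernel_dim (- T) = kernel_dim T"
    using inertia_sum[OF T T_sym] inertia_sum[OF neg.T neg.T_sym] by simp
  have "n * N = (\<Sum>k=1..N. n)" by simp
  also have "\<dots> = (\<Sum>k=1..N. neg_inertia (Q k) + neg_inertia (- Q k) + kernel_dim (Q k))"
    by (intro sum.cong refl inertia_sum[symmetric] Q Q_sym)
  also have "\<dots> \<le> (\<Sum>k=1..N. neg_inertia (Q k) + neg_inertia (- Q k) + (?z k + ?z (k + 1)))"
    by (intro sum_mono add_left_mono kerQ)
  also have "\<dots> = (\<Sum>k=1..N. neg_inertia (Q k)) + (\<Sum>k=1..N. neg_inertia (- Q k))
      + 2 * (\<Sum>k=1..N. ?z k) + ?z (N + 1)"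
    using shift by (simp add: sum.distrib)
  finally show ?thesis
    using flag_dim_le neg.flag_dim_le inertia_sum[OF T T_sym] kT kerT by (simp add: sum.distrib)
qed

end

section \<open>Block tridiagonal matrices\<close>

text \<open>The entries of \<open>block_tridiag\<close> without a bound on the size, so that the same formula
  also describes the matrix extended by one more block column.\<close>

definition tridiag_entry :: "nat \<Rightarrow> (nat \<Rightarrow> real mat) \<Rightarrow> (nat \<Rightarrow> real mat) \<Rightarrow> nat \<Rightarrow> nat \<Rightarrow> real" where
  "tridiag_entry n S R i j = (let
     p = i div n + 1; q = j div n + 1; a = i mod n; b = j mod n in
     if p = q then S p $$ (a, b)
     else if q = p + 1 then R p $$ (a, b)
     else if p = q + 1 then (R q)\<^sup>T $$ (a, b)
     else 0)"

lemma block_tridiag_entry: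
  "block_tridiag n N S R = mat (n * N) (n * N) (\<lambda>(i, j). tridiag_entry n S R i j)"
  unfolding block_tridiag_def tridiag_entry_def by simp

lemma sum_blocks:
  fixes f :: "nat \<Rightarrow> 'a :: comm_monoid_add"
  shows "(\<Sum>j<n * M. f j) = (\<Sum>q<M. \<Sum>b<n. f (q * n + b))"
proof -
  have "(\<Sum>j<n * M. f j) = (\<Sum>q<M. sum f {q * n..<q * n + n})"
    using sum.nat_group[of f n M] by (simp add: mult.commute)
  also have "\<dots> = (\<Sum>q<M. \<Sum>b<n. f (q * n + b))"
  proof (rule sum.cong[OF refl])
    fix q assume "q \<in> {..<M}"
    show "sum f {q * n..<q * n + n} = (\<Sum>b<n. f (q * n + b))"
      using sum.shift_bounds_nat_ivl[of f 0 "q * n" n] by (simp add: add.commute lessThan_atLeast0)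
  qed
  finally show ?thesis .
qed

lemma sum_tridiag_row:
  assumes p: "p < M" and a: "a < n" and R: "p > 0 \<Longrightarrow> R p \<in> carrier_mat n n"
  shows "(\<Sum>j<n * M. tridiag_entry n S R (p * n + a) j * x j)
    = (if p > 0 then \<Sum>b<n. R p $$ (b, a) * x ((p - 1) * n + b) else 0)
      + (\<Sum>b<n. S (p + 1) $$ (a, b) * x (p * n + b))
      + (if p + 1 < M then \<Sum>b<n. R (p + 1) $$ (a, b) * x ((p + 1) * n + b) else 0)"
proof -
  let ?L = "\<lambda>q. if q + 1 = p then \<Sum>b<n. R p $$ (b, a) * x ((p - 1) * n + b) else 0"
  let ?D = "\<lambda>q. if q = p then \<Sum>b<n. S (p + 1) $$ (a, b) * x (p * n + b) else 0"
  let ?U = "\<lambda>q. if q = p + 1 then \<Sum>b<n. R (p + 1) $$ (a, b) * x ((p + 1) * n + b) else 0"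
  have "(\<Sum>b<n. tridiag_entry n S R (p * n + a) (q * n + b) * x (q * n + b)) = ?L q + ?D q + ?U q"
    if q: "q < M" for q
  proof -
    have pn: "(p * n + a) div n = p" "(p * n + a) mod n = a" using a by auto
    have qn: "(q * n + b) div n = q" "(q * n + b) mod n = b" if "b < n" for b using that by auto
    have tr: "(R p)\<^sup>T $$ (a, b) = R p $$ (b, a)" if "b < n" "q + 1 = p" for b
      using R that a by auto
    let ?e = "\<lambda>b. if p = q then S (p + 1) $$ (a, b) else if q = p + 1 then R (p + 1) $$ (a, b)
      else if p = q + 1 then R p $$ (b, a) else 0"
    have "tridiag_entry n S R (p * n + a) (q * n + b) = ?e b" if "b < n" for b
      unfolding tridiag_entry_def Let_def pn qn[OF that] using tr[OF that] by auto
    then have "(\<Sum>b<n. tridiag_entry n S R (p * n + a) (q * n + b) * x (q * n + b))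
        = (\<Sum>b<n. ?e b * x (q * n + b))"
      by (intro sum.cong refl) auto
    also have "\<dots> = ?L q + ?D q + ?U q"
    proof -
      consider "q + 1 = p" | "q = p" | "q = p + 1" | "q + 1 \<noteq> p" "q \<noteq> p" "q \<noteq> p + 1" by blast
      then show ?thesis by cases auto
    qed
    finally show ?thesis .
  qed
  then have "(\<Sum>j<n * M. tridiag_entry n S R (p * n + a) j * x j) = (\<Sum>q<M. ?L q + ?D q + ?U q)"
    unfolding sum_blocks by (intro sum.cong refl) auto
  also have "\<dots> = (\<Sum>q<M. ?L q) + (\<Sum>q<M. ?D q) + (\<Sum>q<M. ?U q)" by (simp add: sum.distrib)
  also have "(\<Sum>q<M. ?L q) = (if p > 0 then \<Sum>b<n. R p $$ (b, a) * x ((p - 1) * n + b) else 0)"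
  proof (cases p)
    case (Suc p')
    then have "(\<Sum>q<M. ?L q) = (\<Sum>q<M. if q = p' then \<Sum>b<n. R p $$ (b, a) * x ((p - 1) * n + b) else 0)"
      by (intro sum.cong) auto
    then show ?thesis using p Suc by simp
  qed simp
  also have "(\<Sum>q<M. ?D q) = (\<Sum>b<n. S (p + 1) $$ (a, b) * x (p * n + b))" using p by simp
  also have "(\<Sum>q<M. ?U q) = (if p + 1 < M then \<Sum>b<n. R (p + 1) $$ (a, b) * x ((p + 1) * n + b) else 0)"
    by simp
  finally show ?thesis .
qed

lemma mult_vec_entry:
  assumes "A \<in> carrier_mat r c" "v \<in> carrier_vec c" "i < r"
  shows "(A *\<^sub>v v) $ i = (\<Sum>j<c. A $$ (i, j) * v $ j)"
  using assms by (auto simp: scalar_prod_def lessThan_atLeast0 intro!: sum.cong)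

lemma mult_mat_entry:
  assumes "A \<in> carrier_mat r k" "B \<in> carrier_mat k c" "i < r" "j < c"
  shows "(A * B) $$ (i, j) = (\<Sum>b<k. A $$ (i, b) * B $$ (b, j))"
  using assms by (auto simp: scalar_prod_def lessThan_atLeast0 intro!: sum.cong)

lemma invertible_mult_vec_zero:
  fixes A :: "real mat"
  assumes A: "A \<in> carrier_mat n n" and inv: "invertible_mat A" and w: "w \<in> carrier_vec n"
  shows "A *\<^sub>v w = 0\<^sub>v n \<Longrightarrow> w = 0\<^sub>v n" "A\<^sup>T *\<^sub>v w = 0\<^sub>v n \<Longrightarrow> w = 0\<^sub>v n"
proof -
  note B = minv[OF A inv]
  show "w = 0\<^sub>v n" if "A *\<^sub>v w = 0\<^sub>v n"
    using assoc_mult_mat_vec[OF B(1) A w] B(3) that w mult_mat_zero_vec[OF B(1)] by simp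
  have BT: "(minv A)\<^sup>T \<in> carrier_mat n n" and AT: "A\<^sup>T \<in> carrier_mat n n" using A B by auto
  have "(minv A)\<^sup>T * A\<^sup>T = 1\<^sub>m n" using transpose_mult[OF A B(1)] B(2) by simp
  then show "w = 0\<^sub>v n" if "A\<^sup>T *\<^sub>v w = 0\<^sub>v n"
    using assoc_mult_mat_vec[OF BT AT w] that w mult_mat_zero_vec[OF BT] by simp
qed

lemma block_index:
  fixes i n M :: nat
  assumes "i < n * M"
  obtains p a where "p < M" "a < n" "i = p * n + a"
proof
  show "i div n < M" using assms by (simp add: less_mult_imp_div_less mult.commute)
  show "i mod n < n" using assms by (cases n) auto
  show "i = i div n * n + i mod n" by simp
qed

lemma tridiag_entry_sym:
  assumes "i < n * N" "j < n * N"
    and S: "\<And>k. k \<in> {1..N} \<Longrightarrow> S k \<in> carrier_mat n n" "\<And>k. k \<in> {1..N} \<Longrightarrow> (S k)\<^sup>T = S k"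
    and R: "\<And>k. k \<in> {1..N} \<Longrightarrow> R k \<in> carrier_mat n n"
  shows "tridiag_entry n S R i j = tridiag_entry n S R j i"
proof -
  have n: "n > 0" using assms(1) by (cases n) auto
  have p: "i div n < N" "j div n < N"
    using assms(1,2) by (auto simp: less_mult_imp_div_less mult.commute)
  have b: "i mod n < n" "j mod n < n" using n by auto
  have Ss: "S k $$ (a, b) = S k $$ (b, a)" if "k \<in> {1..N}" "a < n" "b < n" for k a b
    using S[OF that(1)] that by (metis carrier_matD index_transpose_mat(1))
  have Rt: "(R k)\<^sup>T $$ (a, b) = R k $$ (b, a)" if "k \<in> {1..N}" "a < n" "b < n" for k a b
    using R[OF that(1)] that by auto
  show ?thesis
    unfolding tridiag_entry_def Let_def using p b Ss Rt by auto
qed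

text \<open>A solution \<open>Y\<close> of the three-term recursion of the block tridiagonal matrix, started at
  \<open>Y 1 = 1\<^sub>m n\<close> as if a preceding block were zero.\<close>

locale tridiagonal_recursion =
  fixes n N :: nat and S R Y :: "nat \<Rightarrow> real mat"
  assumes n_pos: "n \<ge> 1" and N_pos: "N \<ge> 1"
    and S: "k \<in> {1..N} \<Longrightarrow> S k \<in> carrier_mat n n"
    and S_sym: "k \<in> {1..N} \<Longrightarrow> (S k)\<^sup>T = S k"
    and R: "k \<in> {1..N} \<Longrightarrow> R k \<in> carrier_mat n n"
    and R_inv: "k \<in> {1..N} \<Longrightarrow> invertible_mat (R k)"
    and Y: "k \<in> {1..N+1} \<Longrightarrow> Y k \<in> carrier_mat n n"
    and Y1: "Y 1 = 1\<^sub>m n"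
    and first_step: "R 1 * Y 2 = - (S 1 * Y 1)"
    and step: "k \<in> {2..N} \<Longrightarrow> R k * Y (k + 1) = - ((R (k - 1))\<^sup>T * Y (k - 1) + S k * Y k)"
begin

abbreviation T :: "real mat" where "T \<equiv> block_tridiag n N S R"

text \<open>The solution truncated after \<open>k\<close> blocks.\<close>

definition W :: "nat \<Rightarrow> real mat" where
  "W k = mat (n * N) n (\<lambda>(i, c). if i < n * k then Y (i div n + 1) $$ (i mod n, c) else 0)"

definition Q :: "nat \<Rightarrow> real mat" where
  "Q k = - ((Y k)\<^sup>T * (R k * Y (k + 1)))"

lemma T: "T \<in> carrier_mat (n * N) (n * N)"
  unfolding block_tridiag_entry by simp

lemma T_sym: "T\<^sup>T = T"
  by (rule eq_matI) (use tridiag_entry_sym[OF _ _ S S_sym R] in \<open>auto simp: block_tridiag_entry\<close>)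

lemma W: "W k \<in> carrier_mat (n * N) n"
  unfolding W_def by simp

lemma W_entry:
  "i < n * N \<Longrightarrow> c < n \<Longrightarrow>
    W k $$ (i, c) = (if i < n * k then Y (i div n + 1) $$ (i mod n, c) else 0)"
  unfolding W_def by simp

lemma Q: "k \<in> {1..N} \<Longrightarrow> Q k \<in> carrier_mat n n"
  unfolding Q_def using Y[of k] Y[of "k + 1"] R[of k] by auto

lemma recursion_entry:
  assumes p: "p < N" and a: "a < n" and c: "c < n"
  shows "(if p > 0 then \<Sum>b<n. R p $$ (b, a) * Y p $$ (b, c) else 0)
      + (\<Sum>b<n. S (p + 1) $$ (a, b) * Y (p + 1) $$ (b, c)) = - (R (p + 1) * Y (p + 2)) $$ (a, c)"
proof (cases p)
  case 0
  have "(R 1 * Y 2) $$ (a, c) = - ((S 1 * Y 1) $$ (a, c))"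
    unfolding first_step using S[of 1] Y[of 1] N_pos a c by auto
  then show ?thesis using mult_mat_entry[OF S Y, of 1 1 a c] N_pos a c 0 by (simp add: numeral_2_eq_2)
next
  case (Suc p')
  have p1: "p + 1 \<in> {2..N}" using p Suc by auto
  have m: "R p \<in> carrier_mat n n" "S (p + 1) \<in> carrier_mat n n" "Y p \<in> carrier_mat n n"
    "Y (p + 1) \<in> carrier_mat n n"
    using p Suc by (auto intro!: R S Y)
  have "R (p + 1) * Y (p + 2) = - ((R p)\<^sup>T * Y p + S (p + 1) * Y (p + 1))"
    using step[OF p1] by simp
  then have "(R (p + 1) * Y (p + 2)) $$ (a, c)
      = - (((R p)\<^sup>T * Y p) $$ (a, c) + (S (p + 1) * Y (p + 1)) $$ (a, c))"
    using m a c by simp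
  also have "((R p)\<^sup>T * Y p) $$ (a, c) = (\<Sum>b<n. R p $$ (b, a) * Y p $$ (b, c))"
    using mult_mat_entry[of "(R p)\<^sup>T" n n "Y p" n a c] m a c by simp
  also have "(S (p + 1) * Y (p + 1)) $$ (a, c) = (\<Sum>b<n. S (p + 1) $$ (a, b) * Y (p + 1) $$ (b, c))"
    using mult_mat_entry[OF m(2,4) a c] .
  finally show ?thesis using Suc by simp
qed

text \<open>A block row of \<open>T\<close> annihilates the solution as soon as all its blocks are present. If
  the columns stop at the diagonal block, the superdiagonal term of the recursion is what is missing.\<close>

lemma recursion_row_sum:
  assumes M: "p < M" and p: "p < N" and a: "a < n" and c: "c < n"
  shows "(\<Sum>j<n * M. tridiag_entry n S R (p * n + a) j * Y (j div n + 1) $$ (j mod n, c))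
      = (if p + 1 < M then 0 else - (R (p + 1) * Y (p + 2)) $$ (a, c))"
proof -
  have Rp: "R p \<in> carrier_mat n n" if "p > 0" using that p by (auto intro!: R)
  let ?x = "\<lambda>j. Y (j div n + 1) $$ (j mod n, c)"
  have block: "(\<Sum>b<n. f b * ?x (q * n + b)) = (\<Sum>b<n. f b * Y (q + 1) $$ (b, c))" for f q
    by (intro sum.cong refl) simp
  have prev: "(if p > 0 then \<Sum>b<n. R p $$ (b, a) * ?x ((p - 1) * n + b) else 0)
      = (if p > 0 then \<Sum>b<n. R p $$ (b, a) * Y p $$ (b, c) else 0)"
    unfolding block by simp
  have "(R (p + 1) * Y (p + 2)) $$ (a, c) = (\<Sum>b<n. R (p + 1) $$ (a, b) * Y (p + 2) $$ (b, c))"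
    by (rule mult_mat_entry[OF R Y a c]) (use p in auto)
  then have "(\<Sum>b<n. R (p + 1) $$ (a, b) * ?x ((p + 1) * n + b)) = (R (p + 1) * Y (p + 2)) $$ (a, c)"
    unfolding block by simp
  moreover have "(\<Sum>j<n * M. tridiag_entry n S R (p * n + a) j * ?x j)
    = (if p > 0 then \<Sum>b<n. R p $$ (b, a) * ?x ((p - 1) * n + b) else 0)
      + (\<Sum>b<n. S (p + 1) $$ (a, b) * ?x (p * n + b))
      + (if p + 1 < M then \<Sum>b<n. R (p + 1) $$ (a, b) * ?x ((p + 1) * n + b) else 0)"
    by (rule sum_tridiag_row[where R = R, OF M a Rp])
  moreover note prev block[of "\<lambda>b. S (p + 1) $$ (a, b)" p] recursion_entry[OF p a c]
  ultimately show ?thesis by (simp only:) simp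
qed

lemma W_mult_vec:
  assumes v: "v \<in> carrier_vec n" and a: "a < n" and q: "q < N"
  shows "(W k *\<^sub>v v) $ (q * n + a) = (if q < k then (Y (q + 1) *\<^sub>v v) $ a else 0)"
proof -
  have i: "q * n + a < n * N"
  proof -
    have "q * n + a < (q + 1) * n" using a by simp
    also have "\<dots> \<le> N * n" using q by (intro mult_le_mono1) simp
    finally show ?thesis by (simp add: mult.commute)
  qed
  have lt: "q * n + a < n * k \<longleftrightarrow> q < k"
  proof
    assume "q < k"
    then have "(q + 1) * n \<le> k * n" by (intro mult_le_mono1) simp
    then show "q * n + a < n * k" using a by (simp add: mult.commute)
  next
    assume "q * n + a < n * k"
    then have "q * n + a < k * n" by (simp only: mult.commute[of n k])
    then have "q * n < k * n" by (rule add_lessD1)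
    then show "q < k" by simp
  qed
  have "(W k *\<^sub>v v) $ (q * n + a)
      = (\<Sum>c<n. (if q < k then Y (q + 1) $$ (a, c) else 0) * v $ c)"
    using i v a lt by (auto simp: W_def scalar_prod_def lessThan_atLeast0 intro!: sum.cong)
  also have "\<dots> = (if q < k then (Y (q + 1) *\<^sub>v v) $ a else 0)"
    using Y[of "q + 1"] q a v
    by (auto simp: scalar_prod_def lessThan_atLeast0 intro!: sum.cong)
  finally show ?thesis .
qed

lemma W_supp:
  assumes v: "v \<in> carrier_vec n" and i: "n * k \<le> i" "i < n * N"
  shows "(W k *\<^sub>v v) $ i = 0"
  using i v by (auto simp: W_def scalar_prod_def)

text \<open>Hence \<open>T *\<^sub>v (W k *\<^sub>v v)\<close> vanishes on the blocks before block \<open>k\<close>, which is the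
  orthogonality of \<open>W k\<close> to the preceding member of the flag.\<close>

lemma TW_entry:
  assumes k: "k \<in> {1..N}" and p: "p < k" and a: "a < n" and c: "c < n"
  shows "(T * W k) $$ (p * n + a, c) = (if p + 1 < k then 0 else - (R k * Y (k + 1)) $$ (a, c))"
proof -
  have kN: "n * k \<le> n * N" using k by simp
  have "p * n + a < (p + 1) * n" using a by simp
  also have "\<dots> \<le> k * n" using p by (intro mult_le_mono1) simp
  also have "k * n = n * k" by (rule mult.commute)
  also note kN
  finally have i: "p * n + a < n * N" .
  let ?y = "\<lambda>j. Y (j div n + 1) $$ (j mod n, c)"
  have "(T * W k) $$ (p * n + a, c)
      = (\<Sum>j<n * N. tridiag_entry n S R (p * n + a) j * (if j < n * k then ?y j else 0))"
    using i c by (auto simp: block_tridiag_entry W_def scalar_prod_def lessThan_atLeast0 intro!: sum.cong)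
  also have "\<dots> = (\<Sum>j<n * k. tridiag_entry n S R (p * n + a) j * ?y j)"
    by (rule sum.mono_neutral_cong_right) (use kN in auto)
  also have "\<dots> = (if p + 1 < k then 0 else - (R (p + 1) * Y (p + 2)) $$ (a, c))"
    by (rule recursion_row_sum) (use p k a c in auto)
  also have "\<dots> = (if p + 1 < k then 0 else - (R k * Y (k + 1)) $$ (a, c))"
  proof (cases "p + 1 < k")
    case False
    then have "k = p + 1" using p by simp
    then show ?thesis by simp
  qed simp
  finally show ?thesis .
qed

lemma TW_mult_vec:
  assumes k: "k \<in> {1..N}" and p: "p < k" and a: "a < n" and v: "v \<in> carrier_vec n"
  shows "(T *\<^sub>v (W k *\<^sub>v v)) $ (p * n + a)
    = (if p + 1 < k then 0 else - ((R k * Y (k + 1)) *\<^sub>v v) $ a)"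
proof -
  have "p * n + a < (p + 1) * n" using a by simp
  also have "\<dots> \<le> N * n" using p k by (intro mult_le_mono1) simp
  finally have i: "p * n + a < n * N" by (simp add: mult.commute)
  have RY: "R k * Y (k + 1) \<in> carrier_mat n n" using R[OF k] Y[of "k + 1"] k by auto
  have "T *\<^sub>v (W k *\<^sub>v v) = (T * W k) *\<^sub>v v" by (rule assoc_mult_mat_vec[OF T W v, symmetric])
  then have "(T *\<^sub>v (W k *\<^sub>v v)) $ (p * n + a) = (\<Sum>c<n. (T * W k) $$ (p * n + a, c) * v $ c)"
    using mult_vec_entry[OF mult_carrier_mat[OF T W] v i] by simp
  also have "\<dots> = (\<Sum>c<n. (if p + 1 < k then 0 else - (R k * Y (k + 1)) $$ (a, c)) * v $ c)"
    using TW_entry[OF k p a] by (intro sum.cong refl) auto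
  also have "\<dots> = (if p + 1 < k then 0 else - ((R k * Y (k + 1)) *\<^sub>v v) $ a)"
  proof -
    have "((R k * Y (k + 1)) *\<^sub>v v) $ a = (\<Sum>c<n. (R k * Y (k + 1)) $$ (a, c) * v $ c)"
      by (rule mult_vec_entry[OF RY v a])
    then show ?thesis by (simp add: sum_negf)
  qed
  finally show ?thesis .
qed

lemma W_form: "(W k)\<^sup>T * (T * W k) = Q k" if k: "k \<in> {1..N}"
proof (rule eq_matI)
  have Yk: "Y k \<in> carrier_mat n n" and RY: "R k * Y (k + 1) \<in> carrier_mat n n"
    using R[OF k] Y[of "k + 1"] Y[of k] k by auto
  fix c c' assume "c < dim_row (Q k)" "c' < dim_col (Q k)"
  then have c: "c < n" "c' < n" using Q[OF k] by auto
  have kN: "n * k \<le> n * N" using k by simp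
  have below: "i < n * N" if "i < n * k" for i by (rule less_le_trans[OF that kN])
  have TW: "T * W k \<in> carrier_mat (n * N) n" using T W[of k] by auto
  have "((W k)\<^sup>T * (T * W k)) $$ (c, c') = (\<Sum>i<n * N. W k $$ (i, c) * (T * W k) $$ (i, c'))"
    using c W[of k] TW by (auto simp: scalar_prod_def lessThan_atLeast0 simp del: assoc_mult_mat intro!: sum.cong)
  also have "\<dots> = (\<Sum>i<n * k. Y (i div n + 1) $$ (i mod n, c) * (T * W k) $$ (i, c'))"
    by (rule sum.mono_neutral_cong_right) (use kN below c in \<open>auto simp: W_entry\<close>)
  also have "\<dots> = (\<Sum>q<k. \<Sum>a<n. Y (q + 1) $$ (a, c) * (if q + 1 < k then 0 else - (R k * Y (k + 1)) $$ (a, c')))"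
    unfolding sum_blocks using TW_entry[OF k _ _ c(2)] by (intro sum.cong refl) auto
  also have "\<dots> = (\<Sum>q<k. if q = k - 1 then \<Sum>a<n. Y k $$ (a, c) * - (R k * Y (k + 1)) $$ (a, c') else 0)"
    using k by (intro sum.cong refl) auto
  also have "\<dots> = (\<Sum>a<n. Y k $$ (a, c) * - (R k * Y (k + 1)) $$ (a, c'))" using k by simp
  also have "\<dots> = Q k $$ (c, c')"
  proof -
    have "((Y k)\<^sup>T * (R k * Y (k + 1))) $$ (c, c') = (\<Sum>a<n. Y k $$ (a, c) * (R k * Y (k + 1)) $$ (a, c'))"
      using mult_mat_entry[of "(Y k)\<^sup>T" n n "R k * Y (k + 1)" n c c'] Yk RY c by simp
    moreover have "Y (k + 1) \<in> carrier_mat n n" using Y[of "k + 1"] k by simp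
    ultimately show ?thesis unfolding Q_def using Yk c by (simp add: sum_negf)
  qed
  finally show "((W k)\<^sup>T * (T * W k)) $$ (c, c') = Q k $$ (c, c')" .
qed (use Q[OF k] W[of k] in auto)

lemma Q_sym: "(Q k)\<^sup>T = Q k" if k: "k \<in> {1..N}"
proof -
  have Wt: "(W k)\<^sup>T \<in> carrier_mat n (n * N)" and TW: "T * W k \<in> carrier_mat (n * N) n"
    using T W[of k] by auto
  have "(Q k)\<^sup>T = (T * W k)\<^sup>T * W k"
    unfolding W_form[OF k, symmetric] using transpose_mult[OF Wt TW] by simp
  also have "(T * W k)\<^sup>T = (W k)\<^sup>T * T" using transpose_mult[OF T W[of k]] T_sym by simp
  also have "(W k)\<^sup>T * T * W k = Q k"
    unfolding W_form[OF k, symmetric] by (rule assoc_mult_mat[OF Wt T W])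
  finally show ?thesis .
qed

lemma Q_form:
  assumes k: "k \<in> {1..N}" and v: "v \<in> carrier_vec n"
  shows "(W k *\<^sub>v v) \<bullet> (T *\<^sub>v (W k *\<^sub>v v)) = v \<bullet> (Q k *\<^sub>v v)"
proof -
  have Wt: "(W k)\<^sup>T \<in> carrier_mat n (n * N)" and TW: "T * W k \<in> carrier_mat (n * N) n"
    using T W[of k] by auto
  have TWv: "T *\<^sub>v (W k *\<^sub>v v) = (T * W k) *\<^sub>v v" by (rule assoc_mult_mat_vec[OF T W v, symmetric])
  have "(W k *\<^sub>v v) \<bullet> (T *\<^sub>v (W k *\<^sub>v v)) = v \<bullet> ((W k)\<^sup>T *\<^sub>v ((T * W k) *\<^sub>v v))"
    unfolding TWv by (rule inner_mult_mat_vec[OF W v]) (use TW v in auto)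
  also have "(W k)\<^sup>T *\<^sub>v ((T * W k) *\<^sub>v v) = Q k *\<^sub>v v"
    unfolding W_form[OF k, symmetric] by (rule assoc_mult_mat_vec[OF Wt TW v, symmetric])
  finally show ?thesis .
qed

lemma W_orthogonal:
  assumes k: "k \<in> {1..N}" and v: "v \<in> carrier_vec n" and x: "x \<in> carrier_vec (n * N)"
    and supp: "\<And>i. n * (k - 1) \<le> i \<Longrightarrow> i < n * N \<Longrightarrow> x $ i = 0"
  shows "x \<bullet> (T *\<^sub>v (W k *\<^sub>v v)) = 0"
proof -
  have "x $ i * (T *\<^sub>v (W k *\<^sub>v v)) $ i = 0" if i: "i < n * N" for i
  proof (cases "n * (k - 1) \<le> i")
    case False
    then have "i < n * (k - 1)" by simp
    then obtain p a where "p < k - 1" "a < n" "i = p * n + a" by (rule block_index)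
    then show ?thesis using TW_mult_vec[OF k _ _ v, of p a] by simp
  qed (use supp i in simp)
  moreover have "dim_vec (T *\<^sub>v (W k *\<^sub>v v)) = n * N" using T by simp
  ultimately show ?thesis unfolding scalar_prod_def by (intro sum.neutral) simp
qed

lemma W_last_block:
  assumes k: "k \<in> {1..N}" and v: "v \<in> carrier_vec n"
    and zero: "\<And>i. n * (k - 1) \<le> i \<Longrightarrow> i < n * N \<Longrightarrow> (W k *\<^sub>v v) $ i = 0"
  shows "Y k *\<^sub>v v = 0\<^sub>v n"
proof (rule eq_vecI)
  fix a assume "a < dim_vec (0\<^sub>v n :: real vec)"
  then have a: "a < n" by simp
  have "(k - 1) * n + a < (k - 1 + 1) * n" using a by simp
  also have "\<dots> \<le> N * n" using k by (intro mult_le_mono1) simp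
  finally have "(W k *\<^sub>v v) $ ((k - 1) * n + a) = 0" by (intro zero) (simp_all add: mult.commute)
  moreover have "k - 1 < N" "k - 1 < k" "k - 1 + 1 = k" using k by auto
  ultimately show "(Y k *\<^sub>v v) $ a = 0\<^sub>v n $ a"
    using W_mult_vec[OF v a, of "k - 1" k] a by simp
qed (use Y[of k] k in auto)

text \<open>Two consecutive zeros of \<open>Y k *\<^sub>v v\<close> propagate down the recursion, the \<open>R k\<close> being
  invertible, to \<open>v = Y 1 *\<^sub>v v = 0\<close>.\<close>

lemma joint_kernel:
  assumes "k \<in> {1..N}" "v \<in> carrier_vec n" "Y k *\<^sub>v v = 0\<^sub>v n" "Y (k + 1) *\<^sub>v v = 0\<^sub>v n"
  shows "v = 0\<^sub>v n"
  using assms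
proof (induction k)
  case (Suc k)
  note v = Suc.prems(2)
  show ?case
  proof (cases "k = 0")
    case True
    then show ?thesis using Suc.prems Y1 by simp
  next
    case False
    then have k: "k \<in> {1..N}" and k2: "Suc k \<in> {2..N}" using Suc.prems(1) by auto
    have m: "(R k)\<^sup>T \<in> carrier_mat n n" "Y k \<in> carrier_mat n n" "S (Suc k) \<in> carrier_mat n n"
      "Y (Suc k) \<in> carrier_mat n n" "R (Suc k) \<in> carrier_mat n n" "Y (Suc k + 1) \<in> carrier_mat n n"
      using k k2 R[of k] Y[of k] S[of "Suc k"] Y[of "Suc k"] R[of "Suc k"] Y[of "Suc k + 1"] by auto
    have Ykv: "Y k *\<^sub>v v \<in> carrier_vec n" using m v by auto
    have "(R (Suc k) * Y (Suc k + 1)) *\<^sub>v v = 0\<^sub>v n"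
      using assoc_mult_mat_vec[OF m(5,6) v] Suc.prems(4) mult_mat_zero_vec[OF m(5)] by simp
    moreover have "(S (Suc k) * Y (Suc k)) *\<^sub>v v = 0\<^sub>v n"
      using assoc_mult_mat_vec[OF m(3,4) v] Suc.prems(3) mult_mat_zero_vec[OF m(3)] by simp
    moreover have "(R (Suc k) * Y (Suc k + 1)) *\<^sub>v v
        = - (((R k)\<^sup>T * Y k) *\<^sub>v v + (S (Suc k) * Y (Suc k)) *\<^sub>v v)"
    proof -
      have RY: "(R k)\<^sup>T * Y k \<in> carrier_mat n n" and SY: "S (Suc k) * Y (Suc k) \<in> carrier_mat n n"
        using m by auto
      have "R (Suc k) * Y (Suc k + 1) = - ((R k)\<^sup>T * Y k + S (Suc k) * Y (Suc k))"
        using step[OF k2] by simp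
      then show ?thesis
        using uminus_mult_mat_vec[of v "(R k)\<^sup>T * Y k + S (Suc k) * Y (Suc k)"]
          add_mult_distrib_mat_vec[OF RY SY v] m v by simp
    qed
    moreover have RYv: "((R k)\<^sup>T * Y k) *\<^sub>v v = (R k)\<^sup>T *\<^sub>v (Y k *\<^sub>v v)"
      by (rule assoc_mult_mat_vec[OF m(1,2) v])
    moreover have RYv_carrier: "(R k)\<^sup>T *\<^sub>v (Y k *\<^sub>v v) \<in> carrier_vec n" using m Ykv by auto
    ultimately have neg: "- ((R k)\<^sup>T *\<^sub>v (Y k *\<^sub>v v)) = 0\<^sub>v n" by simp
    have "(R k)\<^sup>T *\<^sub>v (Y k *\<^sub>v v) = 0\<^sub>v n"
      using arg_cong[OF neg, of uminus] RYv_carrier by simp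
    then have "Y k *\<^sub>v v = 0\<^sub>v n"
      using invertible_mult_vec_zero(2)[OF R[OF k] R_inv[OF k] Ykv] by blast
    then show ?thesis using Suc.IH[OF k v] Suc.prems(3) by simp
  qed
qed simp

lemma Q_zero:
  assumes k: "k \<in> {1..N}" and v: "v \<in> carrier_vec n" and 0: "Y (k + 1) *\<^sub>v v = 0\<^sub>v n"
  shows "Q k *\<^sub>v v = 0\<^sub>v n"
proof -
  have m: "(Y k)\<^sup>T \<in> carrier_mat n n" "R k \<in> carrier_mat n n" "Y (k + 1) \<in> carrier_mat n n"
    "R k * Y (k + 1) \<in> carrier_mat n n"
    using R[OF k] Y[of "k + 1"] Y[of k] k by auto
  have "((Y k)\<^sup>T * (R k * Y (k + 1))) *\<^sub>v v = 0\<^sub>v n"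
    using assoc_mult_mat_vec[OF m(1,4) v] assoc_mult_mat_vec[OF m(2,3) v] 0
      mult_mat_zero_vec[OF m(1)] mult_mat_zero_vec[OF m(2)] by simp
  then show ?thesis unfolding Q_def using m v by (simp add: uminus_mult_mat_vec)
qed

sublocale orthogonal_flag n N T W Q Y
proof
  show "kernel_dim (Y 1) = 0"
    unfolding Y1 kernel_dim_def index_one_mat(3) by (rule kernel_one_mat(1))
next
  fix k and v x :: "real vec" and i
  assume k: "k \<in> {1..N}" and v: "v \<in> carrier_vec n"
  show "(W k *\<^sub>v v) \<bullet> (T *\<^sub>v (W k *\<^sub>v v)) = v \<bullet> (Q k *\<^sub>v v)" by (rule Q_form[OF k v])
  show "(W k *\<^sub>v v) $ i = 0" if "n * k \<le> i" "i < n * N" by (rule W_supp[OF v that])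
  show "x \<bullet> (T *\<^sub>v (W k *\<^sub>v v)) = 0"
    if "x \<in> carrier_vec (n * N)" "\<And>i. n * (k - 1) \<le> i \<Longrightarrow> i < n * N \<Longrightarrow> x $ i = 0"
    by (rule W_orthogonal[OF k v that])
  show "Y k *\<^sub>v v = 0\<^sub>v n"
    if "\<And>i. n * (k - 1) \<le> i \<Longrightarrow> i < n * N \<Longrightarrow> (W k *\<^sub>v v) $ i = 0"
    by (rule W_last_block[OF k v that])
  show "Q k *\<^sub>v v = 0\<^sub>v n" if "Y (k + 1) *\<^sub>v v = 0\<^sub>v n" by (rule Q_zero[OF k v that])
  show "v = 0\<^sub>v n" if "Y k *\<^sub>v v = 0\<^sub>v n" "Y (k + 1) *\<^sub>v v = 0\<^sub>v n"
    by (rule joint_kernel[OF k v that])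
qed (rule T T_sym W Y Q Q_sym, assumption?)+

lemma kernel_dim_Q_le:
  assumes k: "k \<in> {1..N}"
  shows "kernel_dim (Q k) \<le> kernel_dim (Y k) + kernel_dim (Y (k + 1))"
proof -
  have m: "Y k \<in> carrier_mat n n" "Y (k + 1) \<in> carrier_mat n n" "R k * Y (k + 1) \<in> carrier_mat n n"
    using R[OF k] Y[of "k + 1"] Y[of k] k by auto
  let ?B = "- (R k * Y (k + 1))"
  have B: "?B \<in> carrier_mat n n" using m by simp
  obtain K where K: "K \<in> carrier_mat n (kernel_dim ?B)" "indep_cols K" "?B * K = 0\<^sub>m n (kernel_dim ?B)"
    using kernel_basis_mat[OF B] .
  have "Y (k + 1) *\<^sub>v (K *\<^sub>v v) = 0\<^sub>v n" if v: "v \<in> carrier_vec (kernel_dim ?B)" for v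
  proof -
    have Kv: "K *\<^sub>v v \<in> carrier_vec n" using K v by auto
    have RYK: "(R k * Y (k + 1)) *\<^sub>v (K *\<^sub>v v) \<in> carrier_vec n" using m Kv by auto
    have "- ((R k * Y (k + 1)) *\<^sub>v (K *\<^sub>v v)) = ?B *\<^sub>v (K *\<^sub>v v)"
      using m K v by (simp add: uminus_mult_mat_vec)
    also have "\<dots> = 0\<^sub>v n" by (rule mult_mat_vec_zero[OF B K(1,3) v])
    finally have neg: "- ((R k * Y (k + 1)) *\<^sub>v (K *\<^sub>v v)) = 0\<^sub>v n" .
    have "(R k * Y (k + 1)) *\<^sub>v (K *\<^sub>v v) = 0\<^sub>v n" using arg_cong[OF neg, of uminus] RYK by simp
    then have "R k *\<^sub>v (Y (k + 1) *\<^sub>v (K *\<^sub>v v)) = 0\<^sub>v n"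
      using assoc_mult_mat_vec[OF R[OF k] m(2) Kv] by simp
    then show ?thesis
      using invertible_mult_vec_zero(1)[OF R[OF k] R_inv[OF k]] m(2) Kv by auto
  qed
  then have "kernel_dim ?B \<le> kernel_dim (Y (k + 1))"
    by (rule indep_cols_le_kernel_dim[OF m(2) K(1,2)])
  moreover have "Q k = (Y k)\<^sup>T * ?B" unfolding Q_def using m R[OF k] by simp
  ultimately show ?thesis using kernel_dim_transpose_mult_le[OF m(1) B] by simp
qed

text \<open>All block rows but the last determine a vector from its first block: row \<open>p\<close>
  expresses the next block through the two preceding ones, because \<open>R (p + 1)\<close> is invertible.\<close>

lemma forward_substitution:
  assumes x: "x \<in> carrier_vec (n * N)" and first: "\<And>b. b < n \<Longrightarrow> x $ b = 0"
    and rows: "\<And>i. i < n * (N - 1) \<Longrightarrow> (T *\<^sub>v x) $ i = 0"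
  shows "x = 0\<^sub>v (n * N)"
proof -
  have "q < M \<Longrightarrow> b < n \<Longrightarrow> M \<le> N \<Longrightarrow> x $ (q * n + b) = 0" for M q b
  proof (induction M arbitrary: q b)
    case (Suc M)
    show ?case
    proof (cases "q = M")
      case q: True
      show ?thesis
      proof (cases M)
        case 0
        then show ?thesis using q first Suc.prems by simp
      next
        case (Suc p)
        have M: "M \<in> {1..N}" "p < N" "p + 1 < N" using Suc Suc.prems by auto
        let ?w = "vec n (\<lambda>b. x $ (M * n + b))"
        have "(R M *\<^sub>v ?w) $ a = 0" if a: "a < n" for a
        proof -
          have "p * n + a < (p + 1) * n" using a by simp
          also have "\<dots> \<le> (N - 1) * n" using M by (intro mult_le_mono1) simp
          finally have i: "p * n + a < n * (N - 1)" by (simp add: mult.commute)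
          also have "\<dots> \<le> n * N" by simp
          finally have i': "p * n + a < n * N" .
          have "0 = (T *\<^sub>v x) $ (p * n + a)" using rows[OF i] by simp
          also have "\<dots> = (\<Sum>j<n * N. tridiag_entry n S R (p * n + a) j * x $ j)"
            unfolding mult_vec_entry[OF T x i'] using i' by (auto simp: block_tridiag_entry)
          also have "\<dots> = (if p > 0 then \<Sum>b<n. R p $$ (b, a) * x $ ((p - 1) * n + b) else 0)
              + (\<Sum>b<n. S (p + 1) $$ (a, b) * x $ (p * n + b))
              + (if p + 1 < N then \<Sum>b<n. R (p + 1) $$ (a, b) * x $ ((p + 1) * n + b) else 0)"
            by (rule sum_tridiag_row[OF M(2) a R]) (use M in auto)
          also have "(if p > 0 then \<Sum>b<n. R p $$ (b, a) * x $ ((p - 1) * n + b) else 0) = 0"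
            using Suc.IH[of "p - 1"] Suc Suc.prems by auto
          also have "(\<Sum>b<n. S (p + 1) $$ (a, b) * x $ (p * n + b)) = 0"
            using Suc.IH[of p] Suc Suc.prems by auto
          also have "(if p + 1 < N then \<Sum>b<n. R (p + 1) $$ (a, b) * x $ ((p + 1) * n + b) else 0)
              = (\<Sum>b<n. R M $$ (a, b) * x $ (M * n + b))"
            using M(3) Suc by simp
          also have "\<dots> = (R M *\<^sub>v ?w) $ a"
            using mult_vec_entry[OF R[OF M(1)], of ?w a] a by simp
          finally show ?thesis by simp
        qed
        then have "R M *\<^sub>v ?w = 0\<^sub>v n" using R[OF M(1)] by (intro eq_vecI) auto
        then have "?w = 0\<^sub>v n"
          using invertible_mult_vec_zero(1)[OF R[OF M(1)] R_inv[OF M(1)]] by simp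
        then have "?w $ b = 0\<^sub>v n $ b" by simp
        then show ?thesis using q Suc.prems by simp
      qed
    qed (use Suc in auto)
  qed simp
  then have "x $ i = 0" if "i < n * N" for i
    using block_index[OF that] by (metis order_refl)
  then show ?thesis using x by (intro eq_vecI) auto
qed

text \<open>By forward substitution a kernel vector of \<open>T\<close> is \<open>W N *\<^sub>v u\<close> with \<open>u\<close> its first block;
  the last row then says \<open>Y (N + 1) *\<^sub>v u = 0\<close>.\<close>

lemma kernel_dim_T_le: "kernel_dim T \<le> kernel_dim (Y (N + 1))"
proof -
  let ?z = "kernel_dim T"
  have N: "N \<in> {1..N}" and YN: "Y (N + 1) \<in> carrier_mat n n" using N_pos Y by auto
  obtain K where K: "K \<in> carrier_mat (n * N) ?z" "indep_cols K" "T * K = 0\<^sub>m (n * N) ?z"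
    using kernel_basis_mat[OF T] .
  define K1 where "K1 = mat n ?z (\<lambda>(b, c). K $$ (b, c))"
  have K1: "K1 \<in> carrier_mat n ?z" unfolding K1_def by simp
  have nN: "n \<le> n * N" using N_pos by simp
  have Kv: "K *\<^sub>v v = W N *\<^sub>v (K1 *\<^sub>v v)" and YK1: "Y (N + 1) *\<^sub>v (K1 *\<^sub>v v) = 0\<^sub>v n"
    if v: "v \<in> carrier_vec ?z" for v
  proof -
    define u where "u = K1 *\<^sub>v v"
    have u: "u \<in> carrier_vec n" unfolding u_def using K1 v by auto
    define x where "x = K *\<^sub>v v - W N *\<^sub>v u"
    have Kv: "K *\<^sub>v v \<in> carrier_vec (n * N)" and Wu: "W N *\<^sub>v u \<in> carrier_vec (n * N)"
      using K W[OF N] v u by auto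
    have x: "x \<in> carrier_vec (n * N)" unfolding x_def using Kv Wu by simp
    have TKv: "T *\<^sub>v (K *\<^sub>v v) = 0\<^sub>v (n * N)" by (rule mult_mat_vec_zero[OF T K(1,3) v])
    have TWu: "T *\<^sub>v (W N *\<^sub>v u) \<in> carrier_vec (n * N)" using T Wu by auto
    have Tx: "T *\<^sub>v x = - (T *\<^sub>v (W N *\<^sub>v u))"
      unfolding x_def mult_minus_distrib_mat_vec[OF T Kv Wu] TKv using TWu by simp
    have "x = 0\<^sub>v (n * N)"
    proof (rule forward_substitution[OF x])
      fix b assume b: "b < n"
      have "(W N *\<^sub>v u) $ b = u $ b"
        using W_mult_vec[OF u b, of 0 N] N_pos Y1 u by simp
      also have "\<dots> = (K *\<^sub>v v) $ b"
        unfolding u_def using b nN mult_vec_entry[OF K1 v b] mult_vec_entry[OF K(1) v less_le_trans[OF b nN]]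
        by (simp add: K1_def)
      finally show "x $ b = 0" unfolding x_def using less_le_trans[OF b nN] W[OF N] by simp
    next
      fix i assume "i < n * (N - 1)"
      then obtain p a where p: "p < N - 1" "a < n" "i = p * n + a" by (rule block_index)
      have "i < n * N" using \<open>i < n * (N - 1)\<close> by (rule less_le_trans) simp
      then show "(T *\<^sub>v x) $ i = 0"
        unfolding Tx using TW_mult_vec[OF N _ p(2) u, of p] p T by simp
    qed
    have eq: "K *\<^sub>v v = W N *\<^sub>v u"
    proof (rule eq_vecI)
      fix i assume "i < dim_vec (W N *\<^sub>v u)"
      then have i: "i < n * N" using W[OF N] by simp
      have "x $ i = (K *\<^sub>v v) $ i - (W N *\<^sub>v u) $ i" unfolding x_def using i W[OF N] by simp
      then show "(K *\<^sub>v v) $ i = (W N *\<^sub>v u) $ i" unfolding \<open>x = 0\<^sub>v (n * N)\<close> using i by simp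
    qed (use K W[OF N] in simp)
    then show "K *\<^sub>v v = W N *\<^sub>v (K1 *\<^sub>v v)" unfolding u_def .
    have "(R N * Y (N + 1)) *\<^sub>v u = 0\<^sub>v n"
    proof (rule eq_vecI)
      fix a assume "a < dim_vec (0\<^sub>v n :: real vec)"
      then have a: "a < n" by simp
      have "(N - 1) * n + a < (N - 1 + 1) * n" using a by simp
      also have "\<dots> = n * N" using N_pos by simp
      finally have "(T *\<^sub>v (W N *\<^sub>v u)) $ ((N - 1) * n + a) = 0" using TKv eq by simp
      then show "((R N * Y (N + 1)) *\<^sub>v u) $ a = 0\<^sub>v n $ a"
        using TW_mult_vec[OF N _ a u, of "N - 1"] N_pos a by simp
    qed (use R[OF N] in simp)
    then have "R N *\<^sub>v (Y (N + 1) *\<^sub>v u) = 0\<^sub>v n" using assoc_mult_mat_vec[OF R[OF N] YN u] by simp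
    then show "Y (N + 1) *\<^sub>v (K1 *\<^sub>v v) = 0\<^sub>v n"
      using invertible_mult_vec_zero(1)[OF R[OF N] R_inv[OF N], of "Y (N + 1) *\<^sub>v u"] YN u
      unfolding u_def by auto
  qed
  have "indep_cols K1"
  proof (rule indep_colsI[OF K1])
    fix v assume v: "v \<in> carrier_vec ?z" "K1 *\<^sub>v v = 0\<^sub>v n"
    then have "K *\<^sub>v v = 0\<^sub>v (n * N)" using Kv[OF v(1)] mult_mat_zero_vec[OF W[OF N]] by simp
    then show "v = 0\<^sub>v ?z" by (rule indep_colsD[OF K(2,1) v(1)])
  qed
  then show ?thesis using indep_cols_le_kernel_dim[OF YN K1] YK1 by blast
qed

theorem neg_inertia_block_tridiag:
  "neg_inertia T = (\<Sum>k=1..N. neg_inertia (Q k) + kernel_dim (Y k))"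
  by (rule neg_inertia_eq[OF kernel_dim_T_le kernel_dim_Q_le])

end

section \<open>The determinant\<close>

context tridiagonal_recursion
begin

text \<open>The rows \<open>(I, 0, \<dots>, 0)\<close> on top of \<open>M\<close> block rows of the tridiagonal matrix, with
  \<open>M + 1\<close> block columns. The border makes it block lower triangular with diagonal blocks
  \<open>I, R 1, \<dots>, R M\<close>.\<close>

definition bordered :: "nat \<Rightarrow> real mat" where
  "bordered M = mat (n * (M + 1)) (n * (M + 1))
     (\<lambda>(i, j). if i < n then if i = j then 1 else 0 else tridiag_entry n S R (i - n) j)"

lemma det_bordered:
  assumes "M \<le> N"
  shows "det (bordered M) = (\<Prod>k=1..M. det (R k))"
  using assms
proof (induction M)
  case 0
  have "bordered 0 = 1\<^sub>m n" by (rule eq_matI) (auto simp: bordered_def)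
  then show ?case by simp
next
  case (Suc M)
  let ?m = "n * (M + 1)"
  let ?C = "mat n ?m (\<lambda>(a, j). tridiag_entry n S R (n * M + a) j)"
  have k: "M + 1 \<in> {1..N}" using Suc.prems by simp
  have "bordered (Suc M) = four_block_mat (bordered M) (0\<^sub>m ?m n) ?C (R (M + 1))" (is "_ = ?F")
  proof (rule eq_matI)
    have dims: "dim_row ?F = ?m + n" "dim_col ?F = ?m + n"
      using R[OF k] by (auto simp: bordered_def)
    have size: "n * (Suc M + 1) = ?m + n" by simp
    fix i j assume "i < dim_row ?F" "j < dim_col ?F"
    then have i: "i < ?m + n" and j: "j < ?m + n" unfolding dims .
    have lhs: "bordered (Suc M) $$ (i, j)
        = (if i < n then if i = j then 1 else 0 else tridiag_entry n S R (i - n) j)"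
      unfolding bordered_def size using i j by simp
    consider "i < ?m" "j < ?m" | "i < ?m" "?m \<le> j" | "?m \<le> i" "j < ?m" | "?m \<le> i" "?m \<le> j"
      by linarith
    then show "bordered (Suc M) $$ (i, j) = ?F $$ (i, j)"
    proof cases
      case 1
      then show ?thesis unfolding lhs by (simp add: bordered_def)
    next
      case 2
      have "tridiag_entry n S R (i - n) j = 0" if "\<not> i < n"
      proof -
        have "i - n < n * M" using 2(1) that by (simp add: less_diff_conv2)
        then have "(i - n) div n < M" by (simp add: less_mult_imp_div_less mult.commute)
        moreover have "M + 1 \<le> j div n"
          using 2(2) n_pos by (simp add: less_eq_div_iff_mult_less_eq mult.commute)
        ultimately show ?thesis unfolding tridiag_entry_def Let_def by auto
      qed
      moreover have "i \<noteq> j" using 2 by simp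
      ultimately show ?thesis unfolding lhs using 2 j R[OF k] by (simp add: bordered_def)
    next
      case 3
      then have "i - n = n * M + (i - ?m)" "\<not> i < n" by (auto simp: not_less)
      then show ?thesis unfolding lhs using 3 i R[OF k] by (simp add: bordered_def)
    next
      case 4
      have ia: "i - n = M * n + (i - ?m)" "\<not> i < n" using 4 by (auto simp: not_less mult.commute)
      have jb: "j = (M + 1) * n + (j - ?m)" using 4 by (simp add: mult.commute)
      have ab: "i - ?m < n" "j - ?m < n" using i j 4 by auto
      have dm: "(q * n + b) div n = q" "(q * n + b) mod n = b" if "b < n" for q b using that by auto
      have "(i - n) div n = M" "(i - n) mod n = i - ?m" "j div n = M + 1" "j mod n = j - ?m"
        using dm[OF ab(1), of M] dm[OF ab(2), of "M + 1"] unfolding ia(1)[symmetric] jb[symmetric]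
        by blast+
      then have "tridiag_entry n S R (i - n) j = R (M + 1) $$ (i - ?m, j - ?m)"
        unfolding tridiag_entry_def Let_def by simp
      then show ?thesis unfolding lhs using 4 i j ia(2) R[OF k] by (simp add: bordered_def)
    qed
  qed (use R[OF k] in \<open>auto simp: bordered_def\<close>)
  then have "det (bordered (Suc M)) = det (bordered M) * det (R (M + 1))"
    using det_four_block_mat_upper_right_zero[of "bordered M" ?m "0\<^sub>m ?m n" n ?C "R (M + 1)"] R[OF k]
    by (simp add: bordered_def)
  then show ?case using Suc by simp
qed

text \<open>The block column \<open>(Y 1, \<dots>, Y (N + 1))\<close> followed by the first \<open>n * N\<close> unit columns.\<close>

definition shifted :: "real mat" where
  "shifted = mat (n * N + n) (n * N + n) (\<lambda>(i, j).
     if j < n then Y (i div n + 1) $$ (i mod n, j) else if i = j - n then 1 else 0)"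

lemma det_shifted: "det shifted = (- 1) ^ (n * N) * det (Y (N + 1))"
proof -
  have YN: "Y (N + 1) \<in> carrier_mat n n" using Y by simp
  let ?Z = "mat (n * N) n (\<lambda>(i, j). Y (i div n + 1) $$ (i mod n, j))"
  let ?F = "four_block_mat (Y (N + 1)) (0\<^sub>m n (n * N)) ?Z (1\<^sub>m (n * N))"
  \<comment> \<open>Moving the last \<open>n\<close> rows to the top makes the matrix block lower triangular.\<close>
  have "mat (n * N + n) (n * N + n) (\<lambda>(i, j). shifted $$
      (if i < n then i + n * N else if i < n * N + n then i - n else i, j)) = ?F"
  proof (rule eq_matI)
    fix i j assume "i < dim_row ?F" "j < dim_col ?F"
    then have ij: "i < n * N + n" "j < n * N + n" using YN by auto
    have "(n * N + i) div n = N" "(n * N + i) mod n = i" if "i < n" using that by auto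
    then show "mat (n * N + n) (n * N + n) (\<lambda>(i, j). shifted $$
      (if i < n then i + n * N else if i < n * N + n then i - n else i, j)) $$ (i, j) = ?F $$ (i, j)"
      using ij YN by (auto simp: shifted_def add.commute)
  qed (use YN in auto)
  then have "det shifted = (- 1) ^ (n * N * n) * det ?F"
    using det_swap_initial_rows[of shifted "n * N + n" "n * N" n] by (simp add: shifted_def)
  also have "det ?F = det (Y (N + 1))"
    using det_four_block_mat_upper_right_zero[OF YN, of "0\<^sub>m n (n * N)" "n * N" ?Z "1\<^sub>m (n * N)"] by simp
  \<comment> \<open>The row swap contributes \<open>n * N * n\<close> signs, and \<open>n * n\<close> has the parity of \<open>n\<close>.\<close>
  also have "(- 1 :: real) ^ (n * N * n) = (- 1) ^ (n * N)"
    by (cases "even n") (auto simp: minus_one_power_iff)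
  finally show ?thesis .
qed

text \<open>The product is block upper triangular with diagonal blocks \<open>I\<close> and \<open>T\<close>: the unit columns
  pick out columns of \<open>bordered N\<close>, and the first block column is mapped to \<open>(I, 0, \<dots>, 0)\<close> by the
  recursion.\<close>

lemma bordered_mult_shifted: "det (bordered N * shifted) = det T"
proof -
  let ?E = "mat n (n * N) (\<lambda>(i, j). if i = j then 1 else 0)"
  let ?F = "four_block_mat (1\<^sub>m n) ?E (0\<^sub>m (n * N) n) T"
  have size: "n * (N + 1) = n * N + n" by simp
  have "bordered N * shifted = ?F"
  proof (rule eq_matI)
    fix i j assume "i < dim_row ?F" "j < dim_col ?F"
    then have ij: "i < n * N + n" "j < n * N + n" using T by auto
    have prod: "(bordered N * shifted) $$ (i, j)
        = (\<Sum>l<n * N + n. bordered N $$ (i, l) * shifted $$ (l, j))"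
      using ij unfolding bordered_def size shifted_def
      by (auto simp: scalar_prod_def lessThan_atLeast0 intro!: sum.cong)
    show "(bordered N * shifted) $$ (i, j) = ?F $$ (i, j)"
    proof (cases "i < n")
      case True
      have "(bordered N * shifted) $$ (i, j)
          = (\<Sum>l<n * N + n. if l = i then shifted $$ (i, j) else 0)"
        unfolding prod using ij True
        by (intro sum.cong refl) (auto simp: bordered_def)
      also have "\<dots> = shifted $$ (i, j)" using ij by simp
      also have "\<dots> = ?F $$ (i, j)" using ij True Y1 T by (auto simp: shifted_def)
      finally show ?thesis .
    next
      case False
      have row: "bordered N $$ (i, l) = tridiag_entry n S R (i - n) l" if "l < n * N + n" for l
        using False ij that by (simp add: bordered_def)
      have "i - n < n * N" using ij False by auto
      then obtain p a where p: "p < N" "a < n" "i - n = p * n + a" by (rule block_index)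
      show ?thesis
      proof (cases "j < n")
        case True
        have "(bordered N * shifted) $$ (i, j)
            = (\<Sum>l<n * (N + 1). tridiag_entry n S R (p * n + a) l * Y (l div n + 1) $$ (l mod n, j))"
          unfolding prod size using ij True row p(3)
          by (intro sum.cong refl) (auto simp: shifted_def)
        also have "\<dots> = 0" using recursion_row_sum[of p "N + 1" a j] p True by simp
        finally show ?thesis using True False ij T by simp
      next
        case j: False
        have "(bordered N * shifted) $$ (i, j)
            = (\<Sum>l<n * N + n. if l = j - n then tridiag_entry n S R (i - n) (j - n) else 0)"
          unfolding prod using ij j row by (intro sum.cong refl) (auto simp: shifted_def)
        also have "\<dots> = tridiag_entry n S R (i - n) (j - n)" using ij j by simp
        finally show ?thesis using j False ij T by (auto simp: block_tridiag_entry)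
      qed
    qed
  qed (use T in \<open>auto simp: bordered_def shifted_def\<close>)
  then show ?thesis
    using det_four_block_mat_lower_left_zero[OF one_carrier_mat, of ?E n "n * N" "0\<^sub>m (n * N) n" T] T by simp
qed

theorem det_block_tridiag: "det T = (- 1) ^ (n * N) * det (Y (N + 1)) * (\<Prod>k=1..N. det (R k))"
proof -
  have "det (bordered N * shifted) = det (bordered N) * det shifted"
    by (rule det_mult) (auto simp: bordered_def shifted_def)
  then show ?thesis unfolding bordered_mult_shifted det_bordered[OF order_refl] det_shifted by simp
qed

end

section \<open>The transfer matrices\<close>

lemma four_block_mat_eqD:
  assumes "four_block_mat A B C D = four_block_mat A' B' C' D'"
    and "A \<in> carrier_mat n n" "B \<in> carrier_mat n n" "C \<in> carrier_mat n n" "D \<in> carrier_mat n n"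
    and "A' \<in> carrier_mat n n" "B' \<in> carrier_mat n n" "C' \<in> carrier_mat n n" "D' \<in> carrier_mat n n"
  shows "A = A'" "C = C'"
proof -
  have eq: "four_block_mat A B C D $$ (i, j) = four_block_mat A' B' C' D' $$ (i, j)" for i j
    using assms(1) by simp
  show "A = A'"
  proof (rule eq_matI)
    fix i j assume "i < dim_row A'" "j < dim_col A'"
    then show "A $$ (i, j) = A' $$ (i, j)" using eq[of i j] assms(2-) by simp
  qed (use assms(2-) in auto)
  show "C = C'"
  proof (rule eq_matI)
    fix i j assume "i < dim_row C'" "j < dim_col C'"
    then show "C $$ (i, j) = C' $$ (i, j)" using eq[of "n + i" j] assms(2-) by simp
  qed (use assms(2-) in auto)
qed

locale transfer_matrices =
  fixes n N :: nat and S R :: "nat \<Rightarrow> real mat" and Q0 :: "real mat"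
  assumes n: "n \<ge> 1" and N: "N \<ge> 1"
    and S: "k \<in> {1..N} \<Longrightarrow> S k \<in> carrier_mat n n"
    and S_sym: "k \<in> {1..N} \<Longrightarrow> (S k)\<^sup>T = S k"
    and R: "k \<in> {1..N} \<Longrightarrow> R k \<in> carrier_mat n n"
    and R_inv: "k \<in> {1..N} \<Longrightarrow> invertible_mat (R k)"
    and Q0: "Q0 \<in> carrier_mat n n"
begin

abbreviation "X k \<equiv> Phi1 n Q0 S R k"
abbreviation "Y k \<equiv> Phi3 n Q0 S R k"

lemma Phi_mat_blocks:
  assumes "k \<in> {1..N+1}"
  shows "\<exists>B D. Phi_mat n Q0 S R k = four_block_mat (X k) B (Y k) D
    \<and> X k \<in> carrier_mat n n \<and> B \<in> carrier_mat n n \<and> Y k \<in> carrier_mat n n \<and> D \<in> carrier_mat n n"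
proof -
  have "Phi_mat n Q0 S R k \<in> carrier_mat (n + n) (n + n)" using assms
  proof (induction k)
    case (Suc k)
    have M: "M_mat n Q0 S R k \<in> carrier_mat (n + n) (n + n)"
    proof (cases "k = 0")
      case True
      then show ?thesis using Q0 by (auto simp: M_mat_def)
    next
      case False
      then have k: "k \<in> {1..N}" using Suc.prems by auto
      show ?thesis using False minv(1)[OF R[OF k] R_inv[OF k]] S[OF k] R[OF k]
        by (auto simp: M_mat_def intro!: four_block_carrier_mat)
    qed
    have "Phi_mat n Q0 S R k \<in> carrier_mat (n + n) (n + n)"
    proof (cases "k = 0")
      case True
      then show ?thesis by (simp add: mult_2)
    qed (use Suc in auto)
    then show ?case using M by simp
  qed simp
  then have dims: "dim_row (Phi_mat n Q0 S R k) = n + n" "dim_col (Phi_mat n Q0 S R k) = n + n" by auto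
  obtain A B C D where sb: "split_block (Phi_mat n Q0 S R k) n n = (A, B, C, D)"
    by (metis prod_cases4)
  then have "X k = A" "Y k = C" unfolding Phi1_def Phi3_def by auto
  then show ?thesis using split_block[OF sb dims] by blast
qed

lemma carrier_XY: "k \<in> {1..N+1} \<Longrightarrow> X k \<in> carrier_mat n n" "k \<in> {1..N+1} \<Longrightarrow> Y k \<in> carrier_mat n n"
  using Phi_mat_blocks by blast+

lemma XY_1: "X 1 = 1\<^sub>m n" "Y 1 = 1\<^sub>m n"
proof -
  obtain B D where BD: "Phi_mat n Q0 S R 1 = four_block_mat (X 1) B (Y 1) D"
    "X 1 \<in> carrier_mat n n" "B \<in> carrier_mat n n" "Y 1 \<in> carrier_mat n n" "D \<in> carrier_mat n n"
    using Phi_mat_blocks[of 1] by auto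
  have M0: "four_block_mat (1\<^sub>m n) (- Q0) (1\<^sub>m n) (1\<^sub>m n - Q0) \<in> carrier_mat (2 * n) (2 * n)"
    using Q0 by (auto simp: mult_2)
  have "Phi_mat n Q0 S R 1 = four_block_mat (1\<^sub>m n) (- Q0) (1\<^sub>m n) (1\<^sub>m n - Q0)"
    using right_mult_one_mat[OF M0] by (simp add: M_mat_def)
  then show "X 1 = 1\<^sub>m n" "Y 1 = 1\<^sub>m n"
    using four_block_mat_eqD[of "X 1" B "Y 1" D "1\<^sub>m n" "- Q0" "1\<^sub>m n" "1\<^sub>m n - Q0"] BD Q0
      minus_carrier_mat[OF Q0, of "1\<^sub>m n"] by auto
qed

text \<open>The two block rows of \<open>M\<^sub>k\<close> differ by \<open>R\<^sub>k\<^sup>t\<close> in the second column, which gives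
  the first identity; multiplying the lower row by \<open>R\<^sub>k\<close> gives the second. Eliminating \<open>X\<close> between
  consecutive \<open>k\<close> produces the three-term recursion for \<open>Y\<close>.\<close>

lemma XY_step:
  assumes k: "k \<in> {1..N}"
  shows "X (k + 1) = Y (k + 1) + (R k)\<^sup>T * Y k"
    and "R k * Y (k + 1) = - (X k + S k * Y k - Y k)"
proof -
  let ?V = "minv (R k)"
  note V = minv[OF R[OF k] R_inv[OF k]]
  note m = S[OF k] R[OF k] V(1)
  have X: "X k \<in> carrier_mat n n" and Y: "Y k \<in> carrier_mat n n" using carrier_XY k by auto
  have X': "X (k + 1) \<in> carrier_mat n n" and Y': "Y (k + 1) \<in> carrier_mat n n" using carrier_XY k by auto
  let ?a = "- ?V" and ?b = "?V * (1\<^sub>m n - S k + R k * (R k)\<^sup>T)" and ?d = "?V * (1\<^sub>m n - S k)"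
  have a: "?a \<in> carrier_mat n n" and b: "?b \<in> carrier_mat n n" and d: "?d \<in> carrier_mat n n"
    using m by auto
  obtain B D where BD: "Phi_mat n Q0 S R k = four_block_mat (X k) B (Y k) D"
    "B \<in> carrier_mat n n" "D \<in> carrier_mat n n"
    using Phi_mat_blocks[of k] k by auto
  obtain B' D' where BD': "Phi_mat n Q0 S R (k + 1) = four_block_mat (X (k + 1)) B' (Y (k + 1)) D'"
    "B' \<in> carrier_mat n n" "D' \<in> carrier_mat n n"
    using Phi_mat_blocks[of "k + 1"] k by auto
  have "Phi_mat n Q0 S R (k + 1) = four_block_mat ?a ?b ?a ?d * four_block_mat (X k) B (Y k) D"
    using k BD(1) by (simp add: M_mat_def)
  also have "\<dots> = four_block_mat (?a * X k + ?b * Y k) (?a * B + ?b * D) (?a * X k + ?d * Y k) (?a * B + ?d * D)"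
    by (rule mult_four_block_mat[OF a b a d X BD(2) Y BD(3)])
  finally have eq: "four_block_mat (X (k + 1)) B' (Y (k + 1)) D'
      = four_block_mat (?a * X k + ?b * Y k) (?a * B + ?b * D) (?a * X k + ?d * Y k) (?a * B + ?d * D)"
    using BD'(1) by simp
  have X_eq: "X (k + 1) = ?a * X k + ?b * Y k" and Y_eq: "Y (k + 1) = ?a * X k + ?d * Y k"
    using four_block_mat_eqD[OF eq] X Y X' Y' a b d BD BD' by auto
  have RRT: "R k * (R k)\<^sup>T \<in> carrier_mat n n" and RT: "(R k)\<^sup>T \<in> carrier_mat n n"
    and IS: "1\<^sub>m n - S k \<in> carrier_mat n n" using m by auto
  have "?b = ?d + ?V * (R k * (R k)\<^sup>T)" by (rule mult_add_distrib_mat[OF V(1) IS RRT])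
  also have "?V * (R k * (R k)\<^sup>T) = (R k)\<^sup>T"
    using assoc_mult_mat[OF V(1) m(2) RT] V(3) RT by simp
  finally have "?b * Y k = ?d * Y k + (R k)\<^sup>T * Y k"
    using add_mult_distrib_mat[OF d RT Y] by simp
  moreover have "?a * X k + (?d * Y k + (R k)\<^sup>T * Y k) = (?a * X k + ?d * Y k) + (R k)\<^sup>T * Y k"
    by (rule assoc_add_mat[symmetric]) (use a d X Y RT in auto)
  ultimately show "X (k + 1) = Y (k + 1) + (R k)\<^sup>T * Y k" unfolding X_eq Y_eq by simp
  have "R k * Y (k + 1) = R k * (?a * X k) + R k * (?d * Y k)"
    unfolding Y_eq by (rule mult_add_distrib_mat) (use m a d X Y in auto)
  also have "R k * (?a * X k) = - X k"
  proof -
    have "R k * (?a * X k) = (R k * ?a) * X k" using assoc_mult_mat[OF m(2) a X] by simp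
    also have "R k * ?a = - (1\<^sub>m n)" using m V(2) by simp
    also have "- (1\<^sub>m n) * X k = - X k" using X by simp
    finally show ?thesis .
  qed
  also have "R k * (?d * Y k) = Y k - S k * Y k"
  proof -
    have "R k * ?d = (R k * ?V) * (1\<^sub>m n - S k)" using assoc_mult_mat[OF m(2) V(1) IS] by simp
    also have "\<dots> = 1\<^sub>m n - S k" unfolding V(2) by (rule left_mult_one_mat[OF IS])
    finally have "(R k * ?d) * Y k = 1\<^sub>m n * Y k - S k * Y k"
      using minus_mult_distrib_mat[OF one_carrier_mat m(1) Y] by simp
    then show ?thesis using assoc_mult_mat[OF m(2) d Y] Y by simp
  qed
  also have "- X k + (Y k - S k * Y k) = - (X k + S k * Y k - Y k)"
    using X Y m by (intro eq_matI) auto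
  finally show "R k * Y (k + 1) = - (X k + S k * Y k - Y k)" .
qed

lemma Q_perp_eq:
  assumes k: "k \<in> {1..N}"
  shows "Q_perp n Q0 S R k = - ((Y k)\<^sup>T * (R k * Y (k + 1)))"
proof -
  have X: "X k \<in> carrier_mat n n" and Y: "Y k \<in> carrier_mat n n" using carrier_XY k by auto
  note S = S[OF k]
  have YT: "(Y k)\<^sup>T \<in> carrier_mat n n" and SI: "S k - 1\<^sub>m n \<in> carrier_mat n n" 
    and SIY: "(S k - 1\<^sub>m n) * Y k \<in> carrier_mat n n" using Y S by auto
  have "Q_perp n Q0 S R k = (Y k)\<^sup>T * ((S k - 1\<^sub>m n) * Y k) + (Y k)\<^sup>T * X k"
    unfolding Q_perp_def using assoc_mult_mat[OF YT SI Y] by simp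
  also have "\<dots> = (Y k)\<^sup>T * ((S k - 1\<^sub>m n) * Y k + X k)"
    by (rule mult_add_distrib_mat[OF YT SIY X, symmetric])
  also have "(S k - 1\<^sub>m n) * Y k = S k * Y k - Y k"
    using minus_mult_distrib_mat[OF S one_carrier_mat Y] Y by simp
  also have "S k * Y k - Y k + X k = - (R k * Y (k + 1))"
    unfolding XY_step(2)[OF k] using X Y S by (intro eq_matI) auto
  also have "(Y k)\<^sup>T * - (R k * Y (k + 1)) = - ((Y k)\<^sup>T * (R k * Y (k + 1)))"
    using YT R[OF k] carrier_XY(2)[of "k + 1"] k by simp
  finally show ?thesis .
qed

lemma tridiagonal_recursion_Phi3: "tridiagonal_recursion n N S R Y"
proof
  fix k
  show "Y 1 = 1\<^sub>m n" by (rule XY_1)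
  have "X 1 + S 1 * Y 1 - Y 1 = S 1 * Y 1"
    unfolding XY_1 using S[of 1] N by (intro eq_matI) auto
  then show "R 1 * Y 2 = - (S 1 * Y 1)" using XY_step(2)[of 1] N by (simp add: numeral_2_eq_2)
  show "R k * Y (k + 1) = - ((R (k - 1))\<^sup>T * Y (k - 1) + S k * Y k)" if k: "k \<in> {2..N}"
  proof -
    have k1: "k - 1 \<in> {1..N}" "k \<in> {1..N}" "k - 1 + 1 = k" using k by auto
    have m: "R (k - 1) \<in> carrier_mat n n" "Y (k - 1) \<in> carrier_mat n n" "Y k \<in> carrier_mat n n"
      "S k \<in> carrier_mat n n"
      using k1 R S carrier_XY(2)[of "k - 1"] carrier_XY(2)[of k] by auto
    have "X k = Y k + (R (k - 1))\<^sup>T * Y (k - 1)" using XY_step(1)[OF k1(1)] k1(3) by simp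
    then have "X k + S k * Y k - Y k = (R (k - 1))\<^sup>T * Y (k - 1) + S k * Y k"
      using m by (intro eq_matI) auto
    then show ?thesis using XY_step(2)[OF k1(2)] by simp
  qed
  show "n \<ge> 1" "N \<ge> 1" by (rule n, rule N)
  show "S k \<in> carrier_mat n n" "(S k)\<^sup>T = S k" "R k \<in> carrier_mat n n" "invertible_mat (R k)"
    if "k \<in> {1..N}"
    using that S S_sym R R_inv by auto
  show "Y k \<in> carrier_mat n n" if "k \<in> {1..N+1}" by (rule carrier_XY(2)[OF that])
qed

end

theorem corollary1:
  fixes n N :: nat and S R :: "nat \<Rightarrow> real mat" and Q0 :: "real mat"
  assumes "n \<ge> 1" and "N \<ge> 1"
    and "\<And>k. k \<in> {1..N} \<Longrightarrow> S k \<in> carrier_mat n n"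
    and "\<And>k. k \<in> {1..N} \<Longrightarrow> (S k)\<^sup>T = S k"
    and "\<And>k. k \<in> {1..N} \<Longrightarrow> R k \<in> carrier_mat n n"
    and "\<And>k. k \<in> {1..N} \<Longrightarrow> invertible_mat (R k)"
    and "Q0 \<in> carrier_mat n n" and "Q0\<^sup>T = Q0"
  shows "neg_inertia (block_tridiag n N S R)
           = (\<Sum>k=1..N. neg_inertia (Q_perp n Q0 S R k) + kernel_dim (Phi3 n Q0 S R k))
       \<and> det (block_tridiag n N S R)
           = (-1) ^ (n * N) * det (Phi3 n Q0 S R (N + 1)) * (\<Prod>k=1..N. det (R k))"
proof -
  interpret transfer: transfer_matrices n N S R Q0
    using assms(1-7) by unfold_locales auto
  interpret rec: tridiagonal_recursion n N S R "Phi3 n Q0 S R"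
    by (rule transfer.tridiagonal_recursion_Phi3)
  have "Q_perp n Q0 S R k = rec.Q k" if "k \<in> {1..N}" for k
    unfolding rec.Q_def by (rule transfer.Q_perp_eq[OF that])
  then have "(\<Sum>k=1..N. neg_inertia (rec.Q k) + kernel_dim (Phi3 n Q0 S R k))
      = (\<Sum>k=1..N. neg_inertia (Q_perp n Q0 S R k) + kernel_dim (Phi3 n Q0 S R k))"
    by (intro sum.cong refl) auto
  then show ?thesis using rec.neg_inertia_block_tridiag rec.det_block_tridiag by simp
qed

end
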